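(* Let $d\in\mathbb{N}\cup\{\infty\}$, let $X_1$ be a finite nonempty subset of $\mathbb{B}_d$, and let $\mathcal{H}_1=\mathcal{H}_{X_1}$ and $\mathcal{M}_1=\operatorname{Mult}(\mathcal{H}_1)$. Put $r:=\max\{\rho_{\rm ph}(x,y):x,y\in X_1\}$ and fix $R\in(0,1)$. For every $\varepsilon>0$ there exists $N_0\in\mathbb{N}$, depending only on $\varepsilon$, $R$ and $X_1$, such that the following holds: for every $X_2\subseteq\mathbb{B}_d$, with $\mathcal{H}_2=\mathcal{H}_{X_2}$ and $\mathcal{M}_2=\operatorname{Mult}(\mathcal{H}_2)$, if $\delta_M(\mathcal{M}_1,\mathcal{M}_2)<r^{-1}R$, then $$\delta_{RK}(\mathcal{H}_1,\mathcal{H}_2)\le(1+\varepsilon)\,\delta_M(\mathcal{M}_1,\mathcal{M}_2)^{N_0}.$$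
   Context: $\mathbb{B}_d$ is the open unit ball of a complex $d$-dimensional Hilbert space. For $X\subseteq\mathbb{B}_d$, $\mathcal{H}_X$ is the reproducing kernel Hilbert space (RKHS) on $X$ with kernel $k(z,w)=\frac{1}{1-\langle z,w\rangle}$, $z,w\in X$ (the restriction to $X$ of the Drury-Arveson space). For an RKHS $\mathcal{H}$ on a set $X$, $\operatorname{Mult}(\mathcal{H})$ is the algebra of functions $f:X\to\mathbb{C}$ with $f\mathcal{H}\subseteq\mathcal{H}$, viewed as an operator algebra by identifying $f$ with the multiplication operator $M_f$ on $\mathcal{H}$. $\|\varphi\|_{cb}=\sup_m\|\varphi\otimes\mathrm{id}_{M_m}\|$ is the completely bounded norm. For RKHSs $\mathcal{H}_i$ on sets $X_i$ with kernel functions $k^i_x$ ($i=1,2$), an RKHS isomorphism is a bounded linear bijection $T:\mathcal{H}_1\to\mathcal{H}_2$ with $T(k^1_x)=\lambda_xk^2_{F(x)}$ for all $x\in X_1$, where $F:X_1\to X_2$ is a bijection and $x\mapsto\lambda_x\in\mathbb{C}$ is nowhere vanishing. Define $\delta_{RK}(\mathcal{H}_1,\mathcal{H}_2)=\inf\{\|T\|\|T^{-1}\|:T:\mathcal{H}_1\to\mathcal{H}_2\text{ an RKHS isomorphism}\}$. A multiplier algebra isomorphism $\varphi:\operatorname{Mult}(\mathcal{H}_1)\to\operatorname{Mult}(\mathcal{H}_2)$ is a bijective algebra isomorphism of the form $\varphi(f)=f\circ G$ with $G:X_2\to X_1$ a bijection, such that $\varphi$ and $\varphi^{-1}$ are completely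 bounded. Define $\delta_M=\inf\{\|\varphi\|_{cb}\|\varphi^{-1}\|_{cb}\}$ over multiplier algebra isomorphisms $\varphi$. An infimum over the empty set is $+\infty$. The pseudohyperbolic metric on $\mathbb{B}_d$ is $\rho_{\rm ph}(z,w)=\|\Psi_w(z)\|$, where $\Psi_w(z)=\frac{w-P_wz-(1-\|w\|^2)^{1/2}P_w^\perp z}{1-\langle z,w\rangle}$, $P_w$ is the orthogonal projection onto the span of $w$ and $P_w^\perp=I-P_w$. If $X_1$ is a single point, so $r=0$, then $r^{-1}R$ is read as $+\infty$. *)

theory Defs
  imports "HOL-Analysis.Analysis" "HOL-Library.Extended_Nat"
    "HOL-Library.Extended_Nonnegative_Real"
begin

section \<open>The unit ball and the pseudohyperbolic metric\<close>

text \<open>The $d$-dimensional Hilbert space is the space of square-summable sequences supported on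
  the indices below $d$, where $d$ may be infinite.\<close>

definition l2_space :: "enat \<Rightarrow> (nat \<Rightarrow> complex) set" where
  "l2_space d = {z. (\<forall>i. d \<le> enat i \<longrightarrow> z i = 0) \<and> summable (\<lambda>i. (cmod (z i))\<^sup>2)}"

definition l2_inner :: "(nat \<Rightarrow> complex) \<Rightarrow> (nat \<Rightarrow> complex) \<Rightarrow> complex" where
  "l2_inner z w = (\<Sum>i. z i * cnj (w i))"

definition l2_norm :: "(nat \<Rightarrow> complex) \<Rightarrow> real" where
  "l2_norm z = sqrt (\<Sum>i. (cmod (z i))\<^sup>2)"

definition unit_ball :: "enat \<Rightarrow> (nat \<Rightarrow> complex) set" where
  "unit_ball d = {z \<in> l2_space d. l2_norm z < 1}"

text \<open>Orthogonal projection onto the span of \<open>w\<close>; for \<open>w = 0\<close> it is zero.\<close>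

definition l2_proj :: "(nat \<Rightarrow> complex) \<Rightarrow> (nat \<Rightarrow> complex) \<Rightarrow> (nat \<Rightarrow> complex)" where
  "l2_proj w z = (\<lambda>i. l2_inner z w / l2_inner w w * w i)"

definition ball_automorphism :: "(nat \<Rightarrow> complex) \<Rightarrow> (nat \<Rightarrow> complex) \<Rightarrow> (nat \<Rightarrow> complex)" where
  "ball_automorphism w z = (\<lambda>i.
     (w i - l2_proj w z i - complex_of_real (sqrt (1 - (l2_norm w)\<^sup>2)) * (z i - l2_proj w z i))
       / (1 - l2_inner z w))"

definition pseudohyperbolic :: "(nat \<Rightarrow> complex) \<Rightarrow> (nat \<Rightarrow> complex) \<Rightarrow> real" where
  "pseudohyperbolic z w = l2_norm (ball_automorphism w z)"


section \<open>Reproducing kernel Hilbert spaces\<close>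

text \<open>A function on the set \<open>points H\<close> is represented by its extension by zero to the whole type.
  The value \<open>kernel_fun H w\<close> is the kernel function \<open>k\<^sub>w = k(\<cdot>, w)\<close>.\<close>

record 'x function_space =
  points :: "'x set"
  funs :: "('x \<Rightarrow> complex) set"
  ip :: "('x \<Rightarrow> complex) \<Rightarrow> ('x \<Rightarrow> complex) \<Rightarrow> complex"
  kernel_fun :: "'x \<Rightarrow> 'x \<Rightarrow> complex"

definition fnorm :: "'x function_space \<Rightarrow> ('x \<Rightarrow> complex) \<Rightarrow> real" where
  "fnorm H f = sqrt (Re (ip H f f))"

locale rkhs =
  fixes H :: "'x function_space"
  assumes zero_outside: "f \<in> funs H \<Longrightarrow> x \<notin> points H \<Longrightarrow> f x = 0"
    and zero_mem: "(\<lambda>x. 0) \<in> funs H"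
    and add_mem: "f \<in> funs H \<Longrightarrow> g \<in> funs H \<Longrightarrow> (\<lambda>x. f x + g x) \<in> funs H"
    and scale_mem: "f \<in> funs H \<Longrightarrow> (\<lambda>x. c * f x) \<in> funs H"
    and ip_add_left: "f \<in> funs H \<Longrightarrow> g \<in> funs H \<Longrightarrow> h \<in> funs H \<Longrightarrow>
          ip H (\<lambda>x. f x + g x) h = ip H f h + ip H g h"
    and ip_scale_left: "f \<in> funs H \<Longrightarrow> g \<in> funs H \<Longrightarrow> ip H (\<lambda>x. c * f x) g = c * ip H f g"
    and ip_commute: "f \<in> funs H \<Longrightarrow> g \<in> funs H \<Longrightarrow> ip H f g = cnj (ip H g f)"
    and ip_pos: "f \<in> funs H \<Longrightarrow> f \<noteq> (\<lambda>x. 0) \<Longrightarrow> 0 < Re (ip H f f)"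
    and complete: "(\<And>n. s n \<in> funs H) \<Longrightarrow>
          (\<forall>e>0. \<exists>N. \<forall>m\<ge>N. \<forall>n\<ge>N. fnorm H (\<lambda>x. s m x - s n x) < e) \<Longrightarrow>
          \<exists>f\<in>funs H. (\<lambda>n. fnorm H (\<lambda>x. s n x - f x)) \<longlonglongrightarrow> 0"
    and kernel_mem: "w \<in> points H \<Longrightarrow> kernel_fun H w \<in> funs H"
    and reproducing: "f \<in> funs H \<Longrightarrow> w \<in> points H \<Longrightarrow> f w = ip H f (kernel_fun H w)"

text \<open>By the reproducing property and completeness, an RKHS on a set is determined by its kernel;
  hence this predicate describes the space $\mathcal{H}_X$ uniquely.\<close>

definition is_drury_arveson_on :: "(nat \<Rightarrow> complex) set \<Rightarrow> (nat \<Rightarrow> complex) function_space \<Rightarrow> bool"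
  where "is_drury_arveson_on X H \<longleftrightarrow> rkhs H \<and> points H = X \<and>
    (\<forall>z\<in>X. \<forall>w\<in>X. kernel_fun H w z = 1 / (1 - l2_inner z w))"


section \<open>RKHS isomorphisms\<close>

definition op_norm :: "'x function_space \<Rightarrow> 'y function_space \<Rightarrow>
    (('x \<Rightarrow> complex) \<Rightarrow> ('y \<Rightarrow> complex)) \<Rightarrow> ennreal" where
  "op_norm H K T = (SUP f \<in> {f \<in> funs H. fnorm H f \<le> 1}. ennreal (fnorm K (T f)))"

definition rkhs_iso :: "'x function_space \<Rightarrow> 'y function_space \<Rightarrow>
    (('x \<Rightarrow> complex) \<Rightarrow> ('y \<Rightarrow> complex)) \<Rightarrow> bool" where
  "rkhs_iso H K T \<longleftrightarrow>
     bij_betw T (funs H) (funs K) \<and>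
     (\<forall>f\<in>funs H. \<forall>g\<in>funs H. T (\<lambda>x. f x + g x) = (\<lambda>y. T f y + T g y)) \<and>
     (\<forall>c. \<forall>f\<in>funs H. T (\<lambda>x. c * f x) = (\<lambda>y. c * T f y)) \<and>
     op_norm H K T < \<infinity> \<and>
     (\<exists>F l. bij_betw F (points H) (points K) \<and>
       (\<forall>x\<in>points H. l x \<noteq> 0 \<and>
          T (kernel_fun H x) = (\<lambda>y. l x * kernel_fun K (F x) y)))"

definition delta_RK :: "'x function_space \<Rightarrow> 'y function_space \<Rightarrow> ennreal" where
  "delta_RK H K = (INF T \<in> {T. rkhs_iso H K T}.
     op_norm H K T * op_norm K H (inv_into (funs H) T))"


section \<open>Multiplier algebras\<close>

definition Mult :: "'x function_space \<Rightarrow> ('x \<Rightarrow> complex) set" where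
  "Mult H = {f. (\<forall>x. x \<notin> points H \<longrightarrow> f x = 0) \<and> (\<forall>h\<in>funs H. (\<lambda>x. f x * h x) \<in> funs H)}"

text \<open>The norm of an $m \times m$ matrix of multipliers as an operator on the Hilbert space
  direct sum of $m$ copies of \<open>H\<close>. Only the entries with indices below \<open>m\<close> matter.\<close>

definition mult_matrix_norm ::
    "'x function_space \<Rightarrow> nat \<Rightarrow> (nat \<Rightarrow> nat \<Rightarrow> 'x \<Rightarrow> complex) \<Rightarrow> ennreal" where
  "mult_matrix_norm H m A =
     (SUP h \<in> {h. (\<forall>j<m. h j \<in> funs H) \<and> sqrt (\<Sum>j<m. (fnorm H (h j))\<^sup>2) \<le> 1}.
        ennreal (sqrt (\<Sum>i<m. (fnorm H (\<lambda>x. \<Sum>j<m. A i j x * h j x))\<^sup>2)))"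

definition cb_norm :: "'x function_space \<Rightarrow> 'y function_space \<Rightarrow>
    (('x \<Rightarrow> complex) \<Rightarrow> ('y \<Rightarrow> complex)) \<Rightarrow> ennreal" where
  "cb_norm H K \<phi> = (SUP m \<in> {1..}.
     SUP A \<in> {A. (\<forall>i<m. \<forall>j<m. A i j \<in> Mult H) \<and> mult_matrix_norm H m A \<le> 1}.
       mult_matrix_norm K m (\<lambda>i j. \<phi> (A i j)))"

definition mult_iso :: "'x function_space \<Rightarrow> 'y function_space \<Rightarrow>
    (('x \<Rightarrow> complex) \<Rightarrow> ('y \<Rightarrow> complex)) \<Rightarrow> bool" where
  "mult_iso H K \<phi> \<longleftrightarrow>
     bij_betw \<phi> (Mult H) (Mult K) \<and>
     (\<forall>f\<in>Mult H. \<forall>g\<in>Mult H. \<phi> (\<lambda>x. f x + g x) = (\<lambda>y. \<phi> f y + \<phi> g y)) \<and>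
     (\<forall>f\<in>Mult H. \<forall>g\<in>Mult H. \<phi> (\<lambda>x. f x * g x) = (\<lambda>y. \<phi> f y * \<phi> g y)) \<and>
     (\<forall>c. \<forall>f\<in>Mult H. \<phi> (\<lambda>x. c * f x) = (\<lambda>y. c * \<phi> f y)) \<and>
     (\<exists>G. bij_betw G (points K) (points H) \<and>
       (\<forall>f\<in>Mult H. \<forall>y\<in>points K. \<phi> f y = f (G y))) \<and>
     cb_norm H K \<phi> < \<infinity> \<and> cb_norm K H (inv_into (Mult H) \<phi>) < \<infinity>"

definition delta_M :: "'x function_space \<Rightarrow> 'y function_space \<Rightarrow> ennreal" where
  "delta_M H K = (INF \<phi> \<in> {\<phi>. mult_iso H K \<phi>}.
     cb_norm H K \<phi> * cb_norm K H (inv_into (Mult H) \<phi>))"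

end

theory Submission
  imports Defs
begin

text \<open>Normalised at a base point, the kernels of the two spaces are \<open>1 / (1 - A)\<close> and \<open>1 / (1 - B)\<close> with
  Gram kernels \<open>A\<close>, \<open>B\<close> that vanish in the row of the base point. The coordinates of the ball
  automorphism form a row contraction, so the cb norm \<open>a\<close> of the isomorphism makes
  \<open>(a\<^sup>2 - A) / (1 - B)\<close> positive semidefinite. Splitting off the base point and multiplying by the
  partial sums of the geometric series yields
  \<open>1 / (1 - B) \<ge> (\<Sum>n\<le>N. A ^ n / a ^ (2 * n)) \<ge> (1 / a ^ (2 * N)) * (\<Sum>n\<le>N. A ^ n)\<close>. Since the Gram matrix
  \<open>1 / (1 - A)\<close> is bounded below, the last sum already dominates it up to a factor \<open>1 + \<epsilon>\<close> for large \<open>N\<close>.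
  The reverse comparison is the same argument with the inverse isomorphism; there the bound
  \<open>\<delta>\<^sub>M < R / r\<close> is needed, as it keeps the diagonal of \<open>B\<close> below \<open>R\<^sup>2\<close> and so makes \<open>N\<close> independent of
  the second space.\<close>

section \<open>Square-summable sequences and the automorphism identity\<close>

text \<open>Letting \<open>N\<close> grow in the chain of inequalities would only compare
  \<open>1 / (1 - B)\<close> with \<open>1 / (1 - A / a ^ 2)\<close>. To get back to
  \<open>A\<close> the sum has to stop at a finite \<open>N\<close>, which costs the factor
  \<open>a ^ (2 * N)\<close>; this is the origin of the exponent. Each of the two comparisons has
  such an exponent, and it must be chosen from the first space alone. For \<open>A\<close> this
  takes a bound below 1 on the entries and a lower bound for the Gram matrix of the first space. For
  \<open>B\<close> neither is known in advance: the entries are controlled by the diagonal estimate,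
  and the lower bound for \<open>1 / (1 - B)\<close> is taken from the first comparison, in which
  \<open>a\<close> is at most \<open>R / r\<close>. The two constants enter \<open>delta_RK\<close>
  through square roots, which halves the exponents \<open>2 * N\<close> and merges the two factors
  \<open>1 + \<epsilon>\<close> into one. The cb norm sees finite matrices only, whereas the row of
  coordinates may be infinite; hence the truncated rows and the limits of positive kernels.\<close>

definition square_summable :: "(nat \<Rightarrow> complex) \<Rightarrow> bool" where
  "square_summable z \<longleftrightarrow> summable (\<lambda>i. (cmod (z i))\<^sup>2)"

lemma cmod_mult_le_half_squares: "cmod (a * cnj b) \<le> ((cmod a)\<^sup>2 + (cmod b)\<^sup>2) / 2"
  using sum_squares_bound[of "cmod a" "cmod b"] by (simp add: norm_mult)

lemma summable_l2_inner:
  assumes "square_summable z" "square_summable w"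
  shows "summable (\<lambda>i. cmod (z i * cnj (w i)))" "summable (\<lambda>i. z i * cnj (w i))"
proof -
  have s: "summable (\<lambda>i. ((cmod (z i))\<^sup>2 + (cmod (w i))\<^sup>2) / 2)"
    using assms unfolding square_summable_def by (intro summable_divide summable_add)
  show *: "summable (\<lambda>i. cmod (z i * cnj (w i)))"
    by (rule summable_comparison_test[OF _ s]) (use cmod_mult_le_half_squares in auto)
  show "summable (\<lambda>i. z i * cnj (w i))"
    by (rule summable_norm_cancel[OF *])
qed

lemma l2_norm_power2: "square_summable z \<Longrightarrow> (l2_norm z)\<^sup>2 = (\<Sum>i. (cmod (z i))\<^sup>2)"
  unfolding l2_norm_def square_summable_def by (simp add: suminf_nonneg)

lemma l2_norm_nonneg: "square_summable z \<Longrightarrow> 0 \<le> l2_norm z"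
  unfolding l2_norm_def square_summable_def by (simp add: suminf_nonneg)

lemma l2_inner_self:
  assumes "square_summable z"
  shows "l2_inner z z = complex_of_real ((l2_norm z)\<^sup>2)"
proof -
  have "(\<lambda>i. complex_of_real ((cmod (z i))\<^sup>2)) sums complex_of_real (\<Sum>i. (cmod (z i))\<^sup>2)"
    using assms unfolding square_summable_def by (intro sums_of_real) (rule summable_sums)
  then show ?thesis
    unfolding l2_inner_def l2_norm_power2[OF assms]
    by (simp add: complex_norm_square sums_unique[symmetric] del: of_real_power)
qed

text \<open>The mean of the squares replaces Cauchy-Schwarz. It is sharp enough, since it only
  serves to keep \<open>l2_inner z w\<close> below a bound that holds for both squared
  norms.\<close>

lemma cmod_l2_inner_le:
  assumes "square_summable z" "square_summable w"
  shows "cmod (l2_inner z w) \<le> ((l2_norm z)\<^sup>2 + (l2_norm w)\<^sup>2) / 2"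
proof -
  have sz: "summable (\<lambda>i. (cmod (z i))\<^sup>2)" and sw: "summable (\<lambda>i. (cmod (w i))\<^sup>2)"
    using assms unfolding square_summable_def by auto
  have "cmod (l2_inner z w) \<le> (\<Sum>i. cmod (z i * cnj (w i)))"
    unfolding l2_inner_def by (rule summable_norm) (rule summable_l2_inner[OF assms])
  also have "\<dots> \<le> (\<Sum>i. ((cmod (z i))\<^sup>2 + (cmod (w i))\<^sup>2) / 2)"
    by (intro suminf_le cmod_mult_le_half_squares summable_l2_inner[OF assms]
        summable_divide summable_add sz sw)
  also have "\<dots> = ((l2_norm z)\<^sup>2 + (l2_norm w)\<^sup>2) / 2"
    using sz sw assms
    by (simp add: l2_norm_power2 suminf_divide suminf_add[symmetric] summable_add)
  finally show ?thesis .
qed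

lemma l2_inner_commute:
  assumes "square_summable z" "square_summable w"
  shows "l2_inner z w = cnj (l2_inner w z)"
proof -
  have "(\<lambda>i. cnj (w i * cnj (z i))) sums cnj (l2_inner w z)"
    unfolding l2_inner_def sums_cnj by (intro summable_sums summable_l2_inner assms)
  then show ?thesis
    unfolding l2_inner_def by (simp add: mult.commute sums_unique[symmetric])
qed

lemma square_summable_lincomb:
  assumes "square_summable z" "square_summable w"
  shows "square_summable (\<lambda>i. a * z i + b * w i)"
proof -
  have s: "summable (\<lambda>i. 2 * (cmod a)\<^sup>2 * (cmod (z i))\<^sup>2 + 2 * (cmod b)\<^sup>2 * (cmod (w i))\<^sup>2)"
    using assms unfolding square_summable_def by (intro summable_add summable_mult)
  have "(cmod (a * z i + b * w i))\<^sup>2 \<le> 2 * (cmod a)\<^sup>2 * (cmod (z i))\<^sup>2 + 2 * (cmod b)\<^sup>2 * (cmod (w i))\<^sup>2"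
    for i
  proof -
    have "(cmod (a * z i + b * w i))\<^sup>2 \<le> (cmod (a * z i) + cmod (b * w i))\<^sup>2"
      by (intro power_mono norm_triangle_ineq) auto
    also have "\<dots> \<le> 2 * (cmod (a * z i))\<^sup>2 + 2 * (cmod (b * w i))\<^sup>2"
      using sum_squares_bound[of "cmod (a * z i)" "cmod (b * w i)"]
      by (simp add: power2_sum)
    finally show ?thesis by (simp add: norm_mult power_mult_distrib)
  qed
  then show ?thesis
    unfolding square_summable_def by (intro summable_comparison_test[OF _ s]) auto
qed

lemma l2_inner_lincomb_left:
  assumes "square_summable z" "square_summable w" "square_summable u"
  shows "l2_inner (\<lambda>i. a * z i + b * w i) u = a * l2_inner z u + b * l2_inner w u"
proof -
  have "(\<lambda>i. a * (z i * cnj (u i)) + b * (w i * cnj (u i))) sums (a * l2_inner z u + b * l2_inner w u)"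
    unfolding l2_inner_def
    by (intro sums_add sums_mult summable_sums summable_l2_inner assms)
  then show ?thesis
    unfolding l2_inner_def by (simp add: algebra_simps sums_unique[symmetric])
qed

lemma l2_inner_lincomb_right:
  assumes "square_summable z" "square_summable w" "square_summable u"
  shows "l2_inner u (\<lambda>i. a * z i + b * w i) = cnj a * l2_inner u z + cnj b * l2_inner u w"
  using assms
  by (subst l2_inner_commute)
    (simp_all add: square_summable_lincomb l2_inner_lincomb_left
      l2_inner_commute[of z u] l2_inner_commute[of w u])

text \<open>Contains \<open>unit_ball d\<close> for every \<open>d\<close>, so finite and infinite
  dimensions are treated at once.\<close>

definition l2_ball :: "(nat \<Rightarrow> complex) set" where
  "l2_ball = {z. square_summable z \<and> l2_norm z < 1}"

lemma unit_ball_subset: "unit_ball d \<subseteq> l2_ball"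
  by (auto simp: unit_ball_def l2_ball_def l2_space_def square_summable_def)

lemma l2_ballD:
  assumes "z \<in> l2_ball"
  shows "square_summable z" "(l2_norm z)\<^sup>2 < 1"
  using assms l2_norm_nonneg[of z]
  by (auto simp: l2_ball_def power_less_one_iff abs_square_less_1)

lemma cmod_l2_inner_less_1:
  assumes "z \<in> l2_ball" "w \<in> l2_ball"
  shows "cmod (l2_inner z w) < 1"
  using cmod_l2_inner_le[of z w] l2_ballD[OF assms(1)] l2_ballD[OF assms(2)] by simp

lemma one_minus_l2_inner_nonzero:
  assumes "z \<in> l2_ball" "w \<in> l2_ball"
  shows "1 - l2_inner z w \<noteq> 0"
  using cmod_l2_inner_less_1[OF assms] by auto

text \<open>Projection and complement both lie in the span of \<open>a\<close> and \<open>z\<close>.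
  Written as a combination of these two vectors, the automorphism has inner products that
  sesquilinearity expands.\<close>

lemma ball_automorphism_eq:
  "ball_automorphism a z = (\<lambda>i.
     (1 - (1 - complex_of_real (sqrt (1 - (l2_norm a)\<^sup>2))) * (l2_inner z a / l2_inner a a)) / (1 - l2_inner z a) * a i
     + (- complex_of_real (sqrt (1 - (l2_norm a)\<^sup>2)) / (1 - l2_inner z a)) * z i)"
  unfolding ball_automorphism_def l2_proj_def
  by (rule ext) (simp add: add_divide_distrib[symmetric] algebra_simps flip: diff_divide_distrib)

lemma square_summable_ball_automorphism:
  assumes "a \<in> l2_ball" "z \<in> l2_ball"
  shows "square_summable (ball_automorphism a z)"
  unfolding ball_automorphism_eq
  by (intro square_summable_lincomb l2_ballD assms)

text \<open>Sesquilinear expansion leaves a polynomial identity in \<open>t\<close>,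
  \<open>s\<close>, \<open>Z\<close>, \<open>W\<close>, \<open>Q\<close>, which follows from
  \<open>s * s = 1 - t\<close>. It is the reason why normalising the kernel at \<open>a\<close>
  again yields 1 / (1 - Gram kernel).\<close>

lemma ball_automorphism_inner:
  assumes a: "a \<in> l2_ball" and z: "z \<in> l2_ball" and w: "w \<in> l2_ball"
  shows "1 - l2_inner (ball_automorphism a z) (ball_automorphism a w) =
    complex_of_real (1 - (l2_norm a)\<^sup>2) * (1 - l2_inner z w) / ((1 - l2_inner z a) * (1 - l2_inner a w))"
proof -
  note sq = l2_ballD(1)[OF a] l2_ballD(1)[OF z] l2_ballD(1)[OF w]
  define s where "s = complex_of_real (sqrt (1 - (l2_norm a)\<^sup>2))"
  define t where "t = complex_of_real ((l2_norm a)\<^sup>2)"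
  define Z where "Z = l2_inner z a"
  define W where "W = l2_inner a w"
  define Q where "Q = l2_inner z w"
  define \<alpha> where "\<alpha> = 1 - (1 - s) * (Z / t)"
  define \<beta> where "\<beta> = 1 - (1 - s) * (W / t)"
  have "sqrt (1 - (l2_norm a)\<^sup>2) * sqrt (1 - (l2_norm a)\<^sup>2) = 1 - (l2_norm a)\<^sup>2"
    using l2_ballD(2)[OF a] by simp
  from arg_cong[where f = complex_of_real, OF this] have s2: "s * s = 1 - t"
    unfolding s_def t_def by (simp only: of_real_mult of_real_diff of_real_1)
  have aa: "l2_inner a a = t" unfolding t_def by (rule l2_inner_self[OF sq(1)])
  have wa: "l2_inner w a = cnj W" unfolding W_def by (rule l2_inner_commute) (use sq in auto)
  have nz: "1 - Z \<noteq> 0" "1 - W \<noteq> 0"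
    unfolding Z_def W_def using one_minus_l2_inner_nonzero a z w by blast+
  have cs: "cnj s = s" "cnj t = t" by (simp_all add: s_def t_def)
  have e1: "ball_automorphism a z = (\<lambda>i. \<alpha> / (1 - Z) * a i + (- s / (1 - Z)) * z i)"
    unfolding ball_automorphism_eq aa Z_def[symmetric] s_def[symmetric] \<alpha>_def ..
  have e2: "ball_automorphism a w = (\<lambda>i. cnj \<beta> / (1 - cnj W) * a i + (- s / (1 - cnj W)) * w i)"
    unfolding ball_automorphism_eq aa wa s_def[symmetric] \<beta>_def by (simp add: cs)
  have "l2_inner (ball_automorphism a z) (ball_automorphism a w) =
      \<alpha> / (1 - Z) * (\<beta> / (1 - W) * t + - s / (1 - W) * W) + - s / (1 - Z) * (\<beta> / (1 - W) * Z + - s / (1 - W) * Q)"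
    unfolding e1 e2
      l2_inner_lincomb_left[OF sq(1,2) square_summable_lincomb[OF sq(1,3)]]
      l2_inner_lincomb_right[OF sq(1,3) sq(1)] l2_inner_lincomb_right[OF sq(1,3) sq(2)]
    by (simp add: aa Z_def[symmetric] W_def[symmetric] Q_def[symmetric] cs)
  also have "\<dots> = (\<alpha> * \<beta> * t - s * \<alpha> * W - s * \<beta> * Z + s * s * Q) / ((1 - Z) * (1 - W))"
    by (simp add: add_divide_distrib diff_divide_distrib algebra_simps)
  finally have "l2_inner (ball_automorphism a z) (ball_automorphism a w) =
      (\<alpha> * \<beta> * t - s * \<alpha> * W - s * \<beta> * Z + s * s * Q) / ((1 - Z) * (1 - W))" .
  \<comment> \<open>The coefficients contain a division by \<open>t\<close>. For
    \<open>t = 0\<close> the point \<open>a\<close> is 0 and every term with \<open>Z\<close> or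
    \<open>W\<close> drops out; otherwise multiplication by \<open>t\<close> makes
    \<open>t * \<alpha>\<close> and \<open>t * \<beta>\<close> polynomials.\<close>
  moreover have "\<alpha> * \<beta> * t - s * \<alpha> * W - s * \<beta> * Z + s * s * Q = (1 - Z) * (1 - W) - (1 - t) * (1 - Q)"
  proof (cases "t = 0")
    case True
    then have "l2_norm a = 0" unfolding t_def by simp
    then have "s = 1" unfolding s_def by simp
    have "(\<Sum>i. (cmod (a i))\<^sup>2) = 0"
      using \<open>l2_norm a = 0\<close> l2_norm_power2[OF sq(1)] by simp
    then have "a = (\<lambda>i. 0)"
      using sq(1) unfolding square_summable_def by (auto simp: suminf_eq_zero_iff)
    then have "Z = 0" "W = 0" unfolding Z_def W_def l2_inner_def by simp_all
    then show ?thesis using True \<open>s = 1\<close> by (simp add: \<alpha>_def \<beta>_def)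
  next
    case False
    have "t * (\<alpha> * \<beta> * t - s * \<alpha> * W - s * \<beta> * Z + s * s * Q) =
        (t * \<alpha>) * (t * \<beta>) - s * (t * \<alpha>) * W - s * (t * \<beta>) * Z + s * s * t * Q"
      by (simp add: algebra_simps)
    also have "t * \<alpha> = t - (1 - s) * Z" using False by (simp add: \<alpha>_def field_simps)
    also have "t * \<beta> = t - (1 - s) * W" using False by (simp add: \<beta>_def field_simps)
    also have "(t - (1 - s) * Z) * (t - (1 - s) * W) - s * (t - (1 - s) * Z) * W - s * (t - (1 - s) * W) * Z + s * s * t * Q
        = t * t - t * (Z + W) + (1 - s * s) * Z * W + s * s * t * Q"
      by (simp add: algebra_simps)
    also have "\<dots> = t * ((1 - Z) * (1 - W) - (1 - t) * (1 - Q))"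
      unfolding s2 by (simp add: algebra_simps)
    finally show ?thesis using False by simp
  qed
  ultimately have e: "l2_inner (ball_automorphism a z) (ball_automorphism a w) =
      ((1 - Z) * (1 - W) - (1 - t) * (1 - Q)) / ((1 - Z) * (1 - W))" by (simp only:)
  have "1 - t = complex_of_real (1 - (l2_norm a)\<^sup>2)" by (simp add: t_def)
  moreover have "1 - l2_inner (ball_automorphism a z) (ball_automorphism a w) =
      (1 - t) * (1 - Q) / ((1 - Z) * (1 - W))"
    unfolding e using nz by (simp only: diff_divide_distrib) simp
  ultimately show ?thesis
    by (simp only: Z_def[symmetric] W_def[symmetric] Q_def[symmetric])
qed

lemma pseudohyperbolic_power2:
  assumes "a \<in> l2_ball" "z \<in> l2_ball"
  shows "complex_of_real ((pseudohyperbolic z a)\<^sup>2) =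
    l2_inner (ball_automorphism a z) (ball_automorphism a z)"
  unfolding pseudohyperbolic_def
  by (rule l2_inner_self[symmetric, OF square_summable_ball_automorphism[OF assms]])

text \<open>With \<open>p = l2_inner z a\<close>, the automorphism identity at \<open>w = z\<close>
  gives \<open>1 - \<rho>^2 = (1 - |a|^2) (1 - |z|^2) / |1 - p|^2\<close>, which is positive. If
  \<open>\<rho>\<close> were 0, the inequality of the means would give
  \<open>|1 - p| \<le> 1 - (|a|^2 + |z|^2) / 2\<close> and hence
  \<open>|z - a|^2 \<le> 0\<close>.\<close>

lemma pseudohyperbolic_less_1:
  assumes a: "a \<in> l2_ball" and z: "z \<in> l2_ball"
  shows "(pseudohyperbolic z a)\<^sup>2 < 1"
    and "z \<noteq> a \<Longrightarrow> 0 < (pseudohyperbolic z a)\<^sup>2"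
proof -
  note sq = l2_ballD(1)[OF a] l2_ballD(1)[OF z]
  define p where "p = l2_inner z a"
  have cp: "l2_inner a z = cnj p" unfolding p_def by (rule l2_inner_commute) (use sq in auto)
  have nz: "1 - p \<noteq> 0" unfolding p_def by (rule one_minus_l2_inner_nonzero[OF z a])
  have pc: "(1 - p) * (1 - cnj p) = complex_of_real ((cmod (1 - p))\<^sup>2)"
    unfolding complex_norm_square by simp
  have "complex_of_real (1 - (pseudohyperbolic z a)\<^sup>2) =
     complex_of_real (1 - (l2_norm a)\<^sup>2) * complex_of_real (1 - (l2_norm z)\<^sup>2) / complex_of_real ((cmod (1 - p))\<^sup>2)"
    using ball_automorphism_inner[OF a z z] pseudohyperbolic_power2[OF a z]
    by (simp only: of_real_diff of_real_1 cp p_def[symmetric] pc l2_inner_self[OF sq(2)])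
  then have e: "1 - (pseudohyperbolic z a)\<^sup>2 =
     (1 - (l2_norm a)\<^sup>2) * (1 - (l2_norm z)\<^sup>2) / (cmod (1 - p))\<^sup>2"
    by (simp only: of_real_eq_iff flip: of_real_mult of_real_divide)
  have pos: "0 < 1 - (l2_norm a)\<^sup>2" "0 < 1 - (l2_norm z)\<^sup>2" using l2_ballD(2) a z by auto
  then have "0 < 1 - (pseudohyperbolic z a)\<^sup>2" unfolding e using nz by simp
  then show "(pseudohyperbolic z a)\<^sup>2 < 1" by simp
  show "0 < (pseudohyperbolic z a)\<^sup>2" if "z \<noteq> a"
  proof (rule ccontr)
    assume "\<not> ?thesis"
    then have "1 - (pseudohyperbolic z a)\<^sup>2 \<ge> 1" by simp
    then have le: "(cmod (1 - p))\<^sup>2 \<le> (1 - (l2_norm a)\<^sup>2) * (1 - (l2_norm z)\<^sup>2)"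
      unfolding e using nz by (simp add: field_simps)
    also have "\<dots> \<le> (1 - ((l2_norm a)\<^sup>2 + (l2_norm z)\<^sup>2) / 2)\<^sup>2"
    proof -
      have "(1 - p) * (1 - q) = (1 - (p + q) / 2)\<^sup>2 - ((p - q) / 2)\<^sup>2" for p q :: real
        by (simp add: power2_eq_square field_simps)
      then show ?thesis by simp
    qed
    finally have "(cmod (1 - p))\<^sup>2 \<le> (1 - ((l2_norm a)\<^sup>2 + (l2_norm z)\<^sup>2) / 2)\<^sup>2" .
    moreover have "0 \<le> 1 - ((l2_norm a)\<^sup>2 + (l2_norm z)\<^sup>2) / 2" using pos by simp
    ultimately have "cmod (1 - p) \<le> 1 - ((l2_norm a)\<^sup>2 + (l2_norm z)\<^sup>2) / 2"
      by (rule power2_le_imp_le)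
    moreover have "1 - Re p \<le> cmod (1 - p)"
      using complex_Re_le_cmod[of "1 - p"] by simp
    ultimately have "1 - Re p \<le> 1 - ((l2_norm a)\<^sup>2 + (l2_norm z)\<^sup>2) / 2" by (rule order_trans[rotated])
    then have "(l2_norm a)\<^sup>2 + (l2_norm z)\<^sup>2 \<le> 2 * Re p" by (simp add: field_simps)
    moreover have "(l2_norm (\<lambda>i. 1 * z i + (-1) * a i))\<^sup>2 = (l2_norm z)\<^sup>2 + (l2_norm a)\<^sup>2 - 2 * Re p"
    proof -
      have "complex_of_real ((l2_norm (\<lambda>i. 1 * z i + (-1) * a i))\<^sup>2) =
         l2_inner (\<lambda>i. 1 * z i + (-1) * a i) (\<lambda>i. 1 * z i + (-1) * a i)"
        by (rule l2_inner_self[symmetric]) (intro square_summable_lincomb sq)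
      also have "\<dots> = l2_inner z z - p - cnj p + l2_inner a a"
        by (subst l2_inner_lincomb_left l2_inner_lincomb_right, (intro square_summable_lincomb sq)+)+
           (simp add: p_def[symmetric] cp)
      finally have "Re (complex_of_real ((l2_norm (\<lambda>i. 1 * z i + (-1) * a i))\<^sup>2)) = Re \<dots>" by simp
      then show ?thesis by (simp add: l2_inner_self sq)
    qed
    ultimately have "(l2_norm (\<lambda>i. 1 * z i + (-1) * a i))\<^sup>2 = 0"
      using zero_le_power2[of "l2_norm (\<lambda>i. 1 * z i + (-1) * a i)"] by linarith
    moreover have "square_summable (\<lambda>i. 1 * z i + (-1) * a i)"
      by (intro square_summable_lincomb sq)
    ultimately have "z i = a i" for i
      by (subst (asm) l2_norm_power2) (auto simp: square_summable_def suminf_eq_zero_iff)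
    then show False using that by auto
  qed
qed

section \<open>Positive semidefinite kernels on a finite set\<close>

text \<open>The real part makes the form real without asking \<open>P\<close> to be Hermitian. The
  index order fits \<open>P x y = k(x, y)\<close>: the form is then the squared norm of the
  combination of the kernel functions \<open>k_x\<close> with coefficients
  \<open>v x\<close>.\<close>

definition herm_form :: "'a set \<Rightarrow> ('a \<Rightarrow> 'a \<Rightarrow> complex) \<Rightarrow> ('a \<Rightarrow> complex) \<Rightarrow> real" where
  "herm_form I P v = Re (\<Sum>x\<in>I. \<Sum>y\<in>I. v x * cnj (v y) * P y x)"

definition psd :: "'a set \<Rightarrow> ('a \<Rightarrow> 'a \<Rightarrow> complex) \<Rightarrow> bool" where
  "psd I P \<longleftrightarrow> (\<forall>v. 0 \<le> herm_form I P v)"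

text \<open>By the Schur product theorem this is the same as positive semidefiniteness. For Gram kernels it
  is immediate, so matrices never need to be factored.\<close>

definition schur_positive :: "'a set \<Rightarrow> ('a \<Rightarrow> 'a \<Rightarrow> complex) \<Rightarrow> bool" where
  "schur_positive I M \<longleftrightarrow> (\<forall>P. psd I P \<longrightarrow> psd I (\<lambda>x y. M x y * P x y))"

lemma herm_form_cong:
  assumes "\<And>x y. x \<in> I \<Longrightarrow> y \<in> I \<Longrightarrow> P x y = Q x y" "\<And>x. x \<in> I \<Longrightarrow> v x = w x"
  shows "herm_form I P v = herm_form I Q w"
  unfolding herm_form_def using assms by (intro arg_cong[where f = Re] sum.cong refl) auto

lemma psd_cong: "psd I P \<Longrightarrow> (\<And>x y. x \<in> I \<Longrightarrow> y \<in> I \<Longrightarrow> P x y = Q x y) \<Longrightarrow> psd I Q"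
  unfolding psd_def using herm_form_cong[of I P Q] by metis

lemma herm_form_add: "herm_form I (\<lambda>x y. P x y + Q x y) v = herm_form I P v + herm_form I Q v"
  by (simp add: herm_form_def sum.distrib ring_distribs)

lemma herm_form_diff: "herm_form I (\<lambda>x y. P x y - Q x y) v = herm_form I P v - herm_form I Q v"
  by (simp add: herm_form_def sum_subtractf ring_distribs)

lemma herm_form_scale: "herm_form I (\<lambda>x y. of_real c * P x y) v = c * herm_form I P v"
proof -
  have "(\<Sum>x\<in>I. \<Sum>y\<in>I. v x * cnj (v y) * (of_real c * P y x)) =
      of_real c * (\<Sum>x\<in>I. \<Sum>y\<in>I. v x * cnj (v y) * P y x)"
    by (simp add: sum_distrib_left mult_ac)
  then show ?thesis by (simp add: herm_form_def)
qed

lemma herm_form_sum: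
  "herm_form I (\<lambda>x y. \<Sum>s\<in>S. M s x y) v = (\<Sum>s\<in>S. herm_form I (M s) v)"
  by (induction S rule: infinite_finite_induct)
    (simp_all add: herm_form_add, simp_all add: herm_form_def)

lemma herm_form_congruence:
  "herm_form I (\<lambda>x y. b x * P x y * cnj (b y)) v = herm_form I P (\<lambda>x. v x * cnj (b x))"
  unfolding herm_form_def by (simp add: mult_ac)

lemma herm_form_reindex:
  assumes "bij_betw F I J"
  shows "herm_form J P v = herm_form I (\<lambda>x y. P (F x) (F y)) (\<lambda>x. v (F x))"
  unfolding herm_form_def
  by (simp add: sum.reindex_bij_betw[OF assms, symmetric])

lemma herm_form_one: "herm_form I (\<lambda>x y. 1) v = (cmod (\<Sum>x\<in>I. v x))\<^sup>2"
proof -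
  have "(\<Sum>x\<in>I. \<Sum>y\<in>I. v x * cnj (v y) * 1) = (\<Sum>x\<in>I. v x) * cnj (\<Sum>x\<in>I. v x)"
    by (simp add: sum_product)
  also have "\<dots> = complex_of_real ((cmod (\<Sum>x\<in>I. v x))\<^sup>2)"
    by (rule complex_norm_square[symmetric])
  finally show ?thesis unfolding herm_form_def by (simp only: Re_complex_of_real)
qed

lemma herm_form_diag:
  assumes "finite I"
  shows "herm_form I (\<lambda>x y. if x = y then of_real (d x) else 0) v = (\<Sum>x\<in>I. d x * (cmod (v x))\<^sup>2)"
proof -
  have "(\<Sum>x\<in>I. \<Sum>y\<in>I. v x * cnj (v y) * (if y = x then of_real (d y) else 0)) =
      (\<Sum>x\<in>I. v x * cnj (v x) * of_real (d x))"
    using assms by (intro sum.cong refl) (simp add: if_distrib cong: if_cong)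
  also have "\<dots> = (\<Sum>x\<in>I. complex_of_real (d x * (cmod (v x))\<^sup>2))"
    by (simp add: complex_norm_square mult_ac del: of_real_power)
  finally show ?thesis unfolding herm_form_def by simp
qed

lemma herm_form_delta:
  assumes "finite I" "z \<in> I"
  shows "herm_form I P (\<lambda>x. if x = z then 1 else 0) = Re (P z z)"
proof -
  have "(\<Sum>x\<in>I. \<Sum>y\<in>I. (if x = z then 1 else 0) * cnj (if y = z then 1 else 0) * P y x) =
    (\<Sum>x\<in>I. if x = z then (\<Sum>y\<in>I. if y = z then P y x else 0) else 0)"
    by (intro sum.cong refl) (auto intro!: sum.cong)
  also have "\<dots> = P z z" using assms by simp
  finally show ?thesis unfolding herm_form_def by simp
qed

lemma psd_diagonal: "finite I \<Longrightarrow> psd I P \<Longrightarrow> z \<in> I \<Longrightarrow> 0 \<le> Re (P z z)"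
  unfolding psd_def by (metis herm_form_delta)

text \<open>A crude operator norm bound by the size of the matrix times its largest entry. It
  absorbs the tail of the geometric series into a multiple of the sum of squares.\<close>

lemma abs_herm_form_le:
  assumes "finite I" "\<And>x y. x \<in> I \<Longrightarrow> y \<in> I \<Longrightarrow> cmod (P x y) \<le> t"
  shows "\<bar>herm_form I P v\<bar> \<le> real (card I) * t * (\<Sum>x\<in>I. (cmod (v x))\<^sup>2)"
proof (cases "I = {}")
  case True
  then show ?thesis by (simp add: herm_form_def)
next
  case False
  then have t: "0 \<le> t" using assms(2) norm_ge_zero order_trans by blast
  have "\<bar>herm_form I P v\<bar> \<le> cmod (\<Sum>x\<in>I. \<Sum>y\<in>I. v x * cnj (v y) * P y x)"
    unfolding herm_form_def by (rule abs_Re_le_cmod)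
  also have "\<dots> \<le> (\<Sum>x\<in>I. \<Sum>y\<in>I. ((cmod (v x))\<^sup>2 + (cmod (v y))\<^sup>2) / 2 * t)"
  proof (intro sum_norm_le)
    fix x y assume xy: "x \<in> I" "y \<in> I"
    have "cmod (v x) * cmod (v y) \<le> ((cmod (v x))\<^sup>2 + (cmod (v y))\<^sup>2) / 2"
      using sum_squares_bound[of "cmod (v x)" "cmod (v y)"] by simp
    then show "cmod (v x * cnj (v y) * P y x) \<le> ((cmod (v x))\<^sup>2 + (cmod (v y))\<^sup>2) / 2 * t"
      unfolding norm_mult complex_mod_cnj using assms(2)[OF xy(2,1)] t by (intro mult_mono) auto
  qed
  also have "\<dots> = real (card I) * t * (\<Sum>x\<in>I. (cmod (v x))\<^sup>2)"
    by (simp add: sum.distrib sum_divide_distrib[symmetric] sum_distrib_right[symmetric]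
        sum_distrib_left[symmetric] field_simps)
  finally show ?thesis .
qed

section \<open>Closure properties of positive and Schur positive kernels\<close>

lemma psd_one: "psd I (\<lambda>x y. 1)"
  by (simp add: psd_def herm_form_one)

lemma psd_add: "psd I P \<Longrightarrow> psd I Q \<Longrightarrow> psd I (\<lambda>x y. P x y + Q x y)"
  by (simp add: psd_def herm_form_add)

lemma psd_scale: "0 \<le> c \<Longrightarrow> psd I P \<Longrightarrow> psd I (\<lambda>x y. of_real c * P x y)"
  by (simp add: psd_def herm_form_scale)

lemma psd_congruence: "psd I P \<Longrightarrow> psd I (\<lambda>x y. b x * P x y * cnj (b y))"
  by (simp add: psd_def herm_form_congruence)

lemma psd_reindex:
  fixes I :: "'a set"
  assumes "bij_betw F I J" "psd J P"
  shows "psd I (\<lambda>x y. P (F x) (F y))"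
  unfolding psd_def
proof
  fix v :: "'a \<Rightarrow> complex"
  define w where "w y = v (inv_into I F y)" for y
  have "herm_form J P w = herm_form I (\<lambda>x y. P (F x) (F y)) v"
    unfolding herm_form_reindex[OF assms(1)] using bij_betw_inv_into_left[OF assms(1)]
    by (intro herm_form_cong) (auto simp: w_def)
  then show "0 \<le> herm_form I (\<lambda>x y. P (F x) (F y)) v"
    using assms(2) unfolding psd_def by metis
qed

lemma psd_LIMSEQ:
  assumes "\<And>n. psd I (P n)" "\<And>x y. x \<in> I \<Longrightarrow> y \<in> I \<Longrightarrow> (\<lambda>n. P n x y) \<longlonglongrightarrow> Q x y"
  shows "psd I Q"
  unfolding psd_def
proof
  fix v
  have "(\<lambda>n. herm_form I (P n) v) \<longlonglongrightarrow> herm_form I Q v"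
    unfolding herm_form_def by (intro tendsto_intros assms)
  then show "0 \<le> herm_form I Q v"
    using assms(1) unfolding psd_def by (intro LIMSEQ_le_const) auto
qed

lemma schur_positiveD: "schur_positive I M \<Longrightarrow> psd I P \<Longrightarrow> psd I (\<lambda>x y. M x y * P x y)"
  by (simp add: schur_positive_def)

lemma schur_positive_psd: "schur_positive I M \<Longrightarrow> psd I M"
  using schur_positiveD[OF _ psd_one] by fastforce

lemma schur_positive_one: "schur_positive I (\<lambda>x y. 1)"
  by (simp add: schur_positive_def)

lemma schur_positive_zero: "schur_positive I (\<lambda>x y. 0)"
  by (simp add: schur_positive_def psd_def herm_form_def)

lemma schur_positive_rank_one: "schur_positive I (\<lambda>x y. b x * cnj (b y))"
  unfolding schur_positive_def
proof (intro allI impI)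
  fix P assume "psd I P"
  from psd_congruence[OF this, of b] show "psd I (\<lambda>x y. b x * cnj (b y) * P x y)"
    by (simp add: mult_ac)
qed

lemma schur_positive_add:
  "schur_positive I M \<Longrightarrow> schur_positive I N \<Longrightarrow> schur_positive I (\<lambda>x y. M x y + N x y)"
  unfolding schur_positive_def by (auto simp: ring_distribs intro!: psd_add)

lemma schur_positive_mult:
  "schur_positive I M \<Longrightarrow> schur_positive I N \<Longrightarrow> schur_positive I (\<lambda>x y. M x y * N x y)"
  unfolding schur_positive_def by (simp add: mult.assoc)

lemma schur_positive_scale:
  "0 \<le> c \<Longrightarrow> schur_positive I M \<Longrightarrow> schur_positive I (\<lambda>x y. of_real c * M x y)"
  unfolding schur_positive_def by (simp add: mult.assoc psd_scale)

lemma schur_positive_power: "schur_positive I M \<Longrightarrow> schur_positive I (\<lambda>x y. M x y ^ n)"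
  by (induction n) (simp_all add: schur_positive_one schur_positive_mult)

lemma schur_positive_sum:
  "(\<And>s. s \<in> S \<Longrightarrow> schur_positive I (M s)) \<Longrightarrow> schur_positive I (\<lambda>x y. \<Sum>s\<in>S. M s x y)"
  by (induction S rule: infinite_finite_induct)
    (simp_all add: schur_positive_zero schur_positive_add)

lemma schur_positive_LIMSEQ:
  assumes "\<And>n. schur_positive I (M n)" "\<And>x y. x \<in> I \<Longrightarrow> y \<in> I \<Longrightarrow> (\<lambda>n. M n x y) \<longlonglongrightarrow> N x y"
  shows "schur_positive I N"
  unfolding schur_positive_def
proof (intro allI impI)
  fix P assume P: "psd I P"
  show "psd I (\<lambda>x y. N x y * P x y)"
  proof (rule psd_LIMSEQ[where P = "\<lambda>n x y. M n x y * P x y"])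
    show "psd I (\<lambda>x y. M n x y * P x y)" for n
      by (rule schur_positiveD[OF assms(1) P])
  qed (intro tendsto_intros assms(2))
qed

lemma schur_positive_geometric:
  assumes "schur_positive I C" "\<And>x y. x \<in> I \<Longrightarrow> y \<in> I \<Longrightarrow> cmod (C x y) < 1"
  shows "schur_positive I (\<lambda>x y. 1 / (1 - C x y))"
proof (rule schur_positive_LIMSEQ[where M = "\<lambda>n x y. \<Sum>k<n. C x y ^ k"])
  show "schur_positive I (\<lambda>x y. \<Sum>k<n. C x y ^ k)" for n
    by (intro schur_positive_sum schur_positive_power assms)
  show "(\<lambda>n. \<Sum>k<n. C x y ^ k) \<longlonglongrightarrow> 1 / (1 - C x y)" if "x \<in> I" "y \<in> I" for x y
    using geometric_sums[OF assms(2)[OF that]] by (simp add: sums_def)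
qed

text \<open>Since the row and the column of \<open>x0\<close> vanish in \<open>L\<close>, the value
  of the test vector at \<open>x0\<close> is free. Choosing it so that the entries sum to 0 removes
  the contribution of the constant kernel.\<close>

lemma psd_schur_complement:
  assumes I: "finite I" "x0 \<in> I" and c: "\<And>x. x \<in> I \<Longrightarrow> L x x0 = 0" "\<And>x. x \<in> I \<Longrightarrow> L x0 x = 0"
    and psd: "psd I (\<lambda>x y. of_real c * 1 + L x y)"
  shows "psd I L"
  unfolding psd_def
proof
  fix v :: "'a \<Rightarrow> complex"
  define w where "w = (\<lambda>x. if x = x0 then v x - sum v I else v x)"
  have "(\<Sum>x\<in>I. w x) = (\<Sum>x\<in>I. v x - (if x = x0 then sum v I else 0))"
    unfolding w_def by (intro sum.cong refl) simp
  also have "\<dots> = 0" unfolding sum_subtractf using I by simp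
  finally have w0: "(\<Sum>x\<in>I. w x) = 0" .
  have "herm_form I L w = herm_form I L v"
    unfolding herm_form_def using c
    by (intro arg_cong[where f = Re] sum.cong refl) (auto simp: w_def)
  moreover have "0 \<le> herm_form I (\<lambda>x y. of_real c * 1 + L x y) w"
    using psd unfolding psd_def by blast
  ultimately show "0 \<le> herm_form I L v"
    unfolding herm_form_add herm_form_scale herm_form_one w0 by simp
qed

section \<open>Strictly positive kernels\<close>

text \<open>For Hermitian \<open>P\<close> this says that no eigenvalue lies below
  \<open>\<mu>\<close>. A positive \<open>\<mu>\<close> for a Gram matrix of kernel functions is a
  quantitative form of their linear independence.\<close>

definition coercive :: "'a set \<Rightarrow> ('a \<Rightarrow> 'a \<Rightarrow> complex) \<Rightarrow> real \<Rightarrow> bool" where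
  "coercive I P \<mu> \<longleftrightarrow> (\<forall>v. \<mu> * (\<Sum>x\<in>I. (cmod (v x))\<^sup>2) \<le> herm_form I P v)"

lemma coercive_cong:
  "coercive I P \<mu> \<Longrightarrow> (\<And>x y. x \<in> I \<Longrightarrow> y \<in> I \<Longrightarrow> P x y = Q x y) \<Longrightarrow> coercive I Q \<mu>"
  unfolding coercive_def by (simp cong: herm_form_cong)

lemma coercive_zeroD:
  assumes "finite I" "coercive I P \<mu>" "0 < \<mu>" "herm_form I P v = 0" "x \<in> I"
  shows "v x = 0"
proof -
  have "\<mu> * (\<Sum>x\<in>I. (cmod (v x))\<^sup>2) \<le> 0"
    using assms(2,4) unfolding coercive_def by metis
  then have "(\<Sum>x\<in>I. (cmod (v x))\<^sup>2) = 0"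
    using assms(3) by (simp add: mult_le_0_iff antisym sum_nonneg)
  then show ?thesis using assms(1,5) by (simp add: sum_nonneg_eq_0_iff)
qed

text \<open>Schur multiplication by \<open>M\<close> preserves positivity of
  \<open>P - \<mu> * identity\<close> and turns the subtracted part into \<open>\<mu>\<close> times
  the diagonal of \<open>M\<close>, which is at least \<open>\<nu>\<close>.\<close>

lemma coercive_schur:
  assumes I: "finite I" and M: "schur_positive I M" and P: "coercive I P \<mu>"
    and m: "\<And>x. x \<in> I \<Longrightarrow> M x x = of_real (d x)" "\<And>x. x \<in> I \<Longrightarrow> \<nu> \<le> d x" "0 \<le> \<mu>"
  shows "coercive I (\<lambda>x y. M x y * P x y) (\<mu> * \<nu>)"
  unfolding coercive_def
proof
  fix v
  let ?D = "\<lambda>x y. if x = y then complex_of_real \<mu> else 0"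
  have "psd I (\<lambda>x y. P x y - ?D x y)"
    using P unfolding psd_def coercive_def herm_form_diff
    by (simp add: herm_form_diag[OF I, of "\<lambda>_. \<mu>"] sum_distrib_left)
  from schur_positiveD[OF M this]
  have "psd I (\<lambda>x y. M x y * P x y - (if x = y then complex_of_real (\<mu> * d x) else 0))"
    by (rule psd_cong) (auto simp: algebra_simps m(1))
  then have "(\<Sum>x\<in>I. \<mu> * d x * (cmod (v x))\<^sup>2) \<le> herm_form I (\<lambda>x y. M x y * P x y) v"
    unfolding psd_def herm_form_diff herm_form_diag[OF I, of "\<lambda>x. \<mu> * d x"] by simp
  moreover have "\<mu> * \<nu> * (\<Sum>x\<in>I. (cmod (v x))\<^sup>2) \<le> (\<Sum>x\<in>I. \<mu> * d x * (cmod (v x))\<^sup>2)"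
    unfolding sum_distrib_left using m by (intro sum_mono mult_right_mono mult_left_mono) auto
  ultimately show "\<mu> * \<nu> * (\<Sum>x\<in>I. (cmod (v x))\<^sup>2) \<le> herm_form I (\<lambda>x y. M x y * P x y) v"
    by simp
qed

lemma coercive_congruence:
  assumes I: "finite I" and P: "coercive I P \<mu>" "0 < \<mu>" and b: "\<And>x. x \<in> I \<Longrightarrow> b x \<noteq> 0"
  shows "\<exists>\<nu>>0. coercive I (\<lambda>x y. b x * P x y * cnj (b y)) \<nu>"
proof -
  \<comment> \<open>The inserted 1 keeps \<open>Min\<close> meaningful and positive when
    \<open>I\<close> is empty.\<close>
  define m where "m = Min (insert 1 ((\<lambda>x. (cmod (b x))\<^sup>2) ` I))"
  have m: "0 < m" "\<And>x. x \<in> I \<Longrightarrow> m \<le> (cmod (b x))\<^sup>2"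
    unfolding m_def using I b by (auto intro!: Min_le)
  have "\<mu> * m * (\<Sum>x\<in>I. (cmod (v x))\<^sup>2) \<le> herm_form I (\<lambda>x y. b x * P x y * cnj (b y)) v" for v
  proof -
    have "m * (\<Sum>x\<in>I. (cmod (v x))\<^sup>2) \<le> (\<Sum>x\<in>I. (cmod (v x * cnj (b x)))\<^sup>2)"
      unfolding sum_distrib_left
      using m(2) by (intro sum_mono) (simp add: norm_mult power_mult_distrib mult.commute mult_right_mono)
    then have "\<mu> * m * (\<Sum>x\<in>I. (cmod (v x))\<^sup>2) \<le> \<mu> * (\<Sum>x\<in>I. (cmod (v x * cnj (b x)))\<^sup>2)"
      using P(2) by simp
    also have "\<dots> \<le> herm_form I (\<lambda>x y. b x * P x y * cnj (b y)) v"
      unfolding herm_form_congruence using P(1) by (simp only: coercive_def)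
    finally show ?thesis .
  qed
  then show ?thesis unfolding coercive_def using P(2) m(1) by (intro exI[of _ "\<mu> * m"]) auto
qed

text \<open>With \<open>s\<close> the sum of \<open>v\<close> over \<open>I\<close>, the form is
  \<open>|v a + s|^2\<close> plus that of \<open>L\<close>. The latter controls \<open>v\<close> on
  \<open>I\<close> and thereby \<open>s\<close>, and \<open>v a\<close> is recovered as the
  difference of \<open>v a + s\<close> and \<open>s\<close>.\<close>

lemma coercive_insert:
  assumes I: "finite I" "a \<notin> I" and L: "coercive I L \<mu>" "0 < \<mu>"
    and z: "\<And>x. L x a = 0" "\<And>x. L a x = 0"
  shows "\<exists>\<nu>>0. coercive (insert a I) (\<lambda>x y. 1 + L x y) \<nu>"
proof -
  define n where "n = real (card I)"
  \<comment> \<open>From \<open>|v a|^2 \<le> 2 |v a + s|^2 + 2 |s|^2\<close> and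
    \<open>|s|^2 \<le> n * S\<close>, with \<open>S\<close> the sum of squares over
    \<open>I\<close>: the factor 2 asks for \<open>1/2\<close>, and \<open>2 * n\<close> together
    with \<open>S\<close> itself for \<open>2 * n + 1\<close>.\<close>
  define \<nu> where "\<nu> = min (1/2) (\<mu> / (2 * n + 1))"
  have n: "0 \<le> n" by (simp add: n_def)
  have \<nu>: "0 < \<nu>" "\<nu> * 2 \<le> 1" "\<nu> * (2 * n + 1) \<le> \<mu>"
  proof -
    have "\<nu> \<le> \<mu> / (2 * n + 1)" by (simp add: \<nu>_def)
    then show "\<nu> * (2 * n + 1) \<le> \<mu>" using n by (simp add: pos_le_divide_eq)
    have "\<nu> \<le> 1 / 2" unfolding \<nu>_def by (rule min.cobounded1)
    then show "\<nu> * 2 \<le> 1" by simp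
  qed (use L(2) n in \<open>simp add: \<nu>_def\<close>)
  have "\<nu> * (\<Sum>x\<in>insert a I. (cmod (v x))\<^sup>2) \<le> herm_form (insert a I) (\<lambda>x y. 1 + L x y) v" for v
  proof -
    let ?S = "\<Sum>x\<in>I. (cmod (v x))\<^sup>2" and ?s = "\<Sum>x\<in>I. v x"
    have "herm_form (insert a I) L v = herm_form I L v"
      using I z by (simp add: herm_form_def)
    then have f: "(cmod (v a + ?s))\<^sup>2 + \<mu> * ?S \<le> herm_form (insert a I) (\<lambda>x y. 1 + L x y) v"
      unfolding herm_form_add herm_form_one using L(1) I by (simp add: coercive_def)
    have "(cmod ?s)\<^sup>2 = herm_form I (\<lambda>x y. 1) v" by (simp add: herm_form_one)
    also have "\<dots> \<le> n * ?S"
      using abs_herm_form_le[OF I(1), of "\<lambda>x y. 1" 1 v] by (simp add: n_def)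
    finally have s: "(cmod ?s)\<^sup>2 \<le> n * ?S" .
    have "cmod (v a) \<le> cmod (v a + ?s) + cmod ?s"
      using norm_triangle_ineq4[of "v a + ?s" ?s] by simp
    then have "(cmod (v a))\<^sup>2 \<le> (cmod (v a + ?s) + cmod ?s)\<^sup>2" by (intro power_mono) auto
    also have "\<dots> \<le> 2 * (cmod (v a + ?s))\<^sup>2 + 2 * (cmod ?s)\<^sup>2"
      using sum_squares_bound[of "cmod (v a + ?s)" "cmod ?s"] by (simp add: power2_sum)
    finally have "(cmod (v a))\<^sup>2 + ?S \<le> 2 * (cmod (v a + ?s))\<^sup>2 + (2 * n + 1) * ?S"
      using s by (simp add: algebra_simps)
    then have "\<nu> * ((cmod (v a))\<^sup>2 + ?S) \<le> \<nu> * (2 * (cmod (v a + ?s))\<^sup>2 + (2 * n + 1) * ?S)"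
      using \<nu>(1) by simp
    also have "\<dots> = (\<nu> * 2) * (cmod (v a + ?s))\<^sup>2 + (\<nu> * (2 * n + 1)) * ?S"
      by (simp add: algebra_simps)
    also have "\<dots> \<le> 1 * (cmod (v a + ?s))\<^sup>2 + \<mu> * ?S"
      using \<nu> by (intro add_mono mult_right_mono sum_nonneg) auto
    finally show ?thesis using f I by simp
  qed
  then show ?thesis unfolding coercive_def using \<nu>(1) by blast
qed

section \<open>The Drury--Arveson kernel normalised at a point\<close>

definition mobius_gram :: "(nat \<Rightarrow> complex) \<Rightarrow> (nat \<Rightarrow> complex) \<Rightarrow> (nat \<Rightarrow> complex) \<Rightarrow> complex" where
  "mobius_gram a z w = l2_inner (ball_automorphism a z) (ball_automorphism a w)"

text \<open>The reciprocal at \<open>z\<close> of the normalised kernel function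
  \<open>k_a / ||k_a||\<close>.\<close>

definition weight :: "(nat \<Rightarrow> complex) \<Rightarrow> (nat \<Rightarrow> complex) \<Rightarrow> complex" where
  "weight a z = (1 - l2_inner z a) / complex_of_real (sqrt (1 - (l2_norm a)\<^sup>2))"

lemma weight_nonzero:
  assumes "a \<in> l2_ball" "z \<in> l2_ball"
  shows "weight a z \<noteq> 0"
  using one_minus_l2_inner_nonzero[OF assms(2,1)] l2_ballD(2)[OF assms(1)]
  by (simp add: weight_def)

text \<open>The automorphism identity inverted. The original and the normalised kernel thus differ
  by a congruence with nowhere vanishing weights, which preserves positivity and strict
  positivity.\<close>

lemma normalised_kernel_eq:
  assumes "a \<in> l2_ball" "z \<in> l2_ball" "w \<in> l2_ball"
  shows "1 / (1 - mobius_gram a z w) = weight a z * (1 / (1 - l2_inner z w)) * cnj (weight a w)"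
proof -
  have "0 < 1 - (l2_norm a)\<^sup>2" using l2_ballD(2)[OF assms(1)] by simp
  then have "sqrt (1 - (l2_norm a)\<^sup>2) * sqrt (1 - (l2_norm a)\<^sup>2) = 1 - (l2_norm a)\<^sup>2" by simp
  from arg_cong[where f = complex_of_real, OF this]
  have s: "complex_of_real (sqrt (1 - (l2_norm a)\<^sup>2)) * complex_of_real (sqrt (1 - (l2_norm a)\<^sup>2))
      = complex_of_real (1 - (l2_norm a)\<^sup>2)" by (simp only: of_real_mult)
  have c: "cnj (l2_inner w a) = l2_inner a w"
    using l2_inner_commute[of a w] assms l2_ballD(1) by simp
  have "1 - mobius_gram a z w = complex_of_real (1 - (l2_norm a)\<^sup>2) * (1 - l2_inner z w) / ((1 - l2_inner z a) * (1 - l2_inner a w))"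
    unfolding mobius_gram_def by (rule ball_automorphism_inner[OF assms])
  then show ?thesis
    unfolding weight_def complex_cnj_divide complex_cnj_diff complex_cnj_one complex_cnj_complex_of_real c
    by (simp only: s[symmetric]) simp
qed

text \<open>The automorphism at \<open>a\<close> sends \<open>a\<close> to 0, so the normalised
  kernel equals 1 in the row and the column of \<open>a\<close>.\<close>

lemma mobius_gram_base:
  assumes "a \<in> l2_ball" "w \<in> l2_ball"
  shows "mobius_gram a a w = 0" "mobius_gram a w a = 0"
proof -
  have n: "complex_of_real (1 - (l2_norm a)\<^sup>2) = 1 - l2_inner a a" "1 - l2_inner a a \<noteq> 0"
    using l2_inner_self[OF l2_ballD(1)[OF assms(1)]] one_minus_l2_inner_nonzero assms by auto
  have "1 - mobius_gram a a w = 1" "1 - mobius_gram a w a = 1"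
    unfolding mobius_gram_def
    using ball_automorphism_inner[OF assms(1) assms(1) assms(2)]
      ball_automorphism_inner[OF assms(1) assms(2) assms(1)]
      one_minus_l2_inner_nonzero[OF assms] one_minus_l2_inner_nonzero[OF assms(2,1)] n
    by simp_all
  then show "mobius_gram a a w = 0" "mobius_gram a w a = 0" by simp_all
qed

lemma mobius_gram_diagonal:
  assumes "a \<in> l2_ball" "z \<in> l2_ball"
  shows "mobius_gram a z z = complex_of_real ((pseudohyperbolic z a)\<^sup>2)"
  unfolding mobius_gram_def by (rule pseudohyperbolic_power2[OF assms, symmetric])

lemma cmod_mobius_gram_le:
  assumes "a \<in> l2_ball" "z \<in> l2_ball" "w \<in> l2_ball"
    and "(pseudohyperbolic z a)\<^sup>2 \<le> q" "(pseudohyperbolic w a)\<^sup>2 \<le> q"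
  shows "cmod (mobius_gram a z w) \<le> q"
proof -
  have "cmod (mobius_gram a z w) \<le> ((pseudohyperbolic z a)\<^sup>2 + (pseudohyperbolic w a)\<^sup>2) / 2"
    unfolding mobius_gram_def pseudohyperbolic_def
    by (intro cmod_l2_inner_le square_summable_ball_automorphism assms)
  also have "\<dots> \<le> q" using assms(4,5) by simp
  finally show ?thesis .
qed

lemma cmod_mobius_gram_less_1:
  assumes "a \<in> l2_ball" "z \<in> l2_ball" "w \<in> l2_ball"
  shows "cmod (mobius_gram a z w) < 1"
proof -
  have "cmod (mobius_gram a z w) \<le> max ((pseudohyperbolic z a)\<^sup>2) ((pseudohyperbolic w a)\<^sup>2)"
    by (intro cmod_mobius_gram_le assms) auto
  also have "\<dots> < 1" using pseudohyperbolic_less_1(1) assms by simp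
  finally show ?thesis .
qed

text \<open>The coordinates from \<open>m\<close> on form a series of rank one kernels.
  \<open>m = 0\<close> gives the whole Gram kernel; general \<open>m\<close> compensates for
  truncating a row of coordinates.\<close>

lemma schur_positive_l2_tail:
  assumes "\<And>x. x \<in> I \<Longrightarrow> square_summable (b x)"
  shows "schur_positive I (\<lambda>x y. l2_inner (b x) (b y) - (\<Sum>l<m. b x l * cnj (b y l)))"
proof (rule schur_positive_LIMSEQ[where M = "\<lambda>n x y. \<Sum>l<n. b x (l + m) * cnj (b y (l + m))"])
  show "schur_positive I (\<lambda>x y. \<Sum>l<n. b x (l + m) * cnj (b y (l + m)))" for n
    by (intro schur_positive_sum schur_positive_rank_one)
  show "(\<lambda>n. \<Sum>l<n. b x (l + m) * cnj (b y (l + m))) \<longlonglongrightarrow> l2_inner (b x) (b y) - (\<Sum>l<m. b x l * cnj (b y l))"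
    if "x \<in> I" "y \<in> I" for x y
    using sums_split_initial_segment[OF summable_sums[OF summable_l2_inner(2)[OF assms[OF that(1)] assms[OF that(2)]]], of m]
    unfolding l2_inner_def sums_def .
qed

lemma schur_positive_mobius_gram:
  assumes "a \<in> l2_ball" "X \<subseteq> l2_ball"
  shows "schur_positive X (mobius_gram a)"
proof -
  have "schur_positive X (\<lambda>x y. mobius_gram a x y - (\<Sum>l<0. ball_automorphism a x l * cnj (ball_automorphism a y l)))"
    unfolding mobius_gram_def
    by (rule schur_positive_l2_tail) (use square_summable_ball_automorphism assms in blast)
  then show ?thesis by simp
qed

lemma coercive_normalised_kernel:
  assumes X: "finite X" "X \<subseteq> l2_ball" and a: "a \<in> l2_ball"
    and co: "coercive X (\<lambda>x y. 1 / (1 - l2_inner x y)) \<mu>" "0 < \<mu>"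
  shows "\<exists>\<nu>>0. coercive X (\<lambda>x y. 1 / (1 - mobius_gram a x y)) \<nu>"
proof -
  have "\<exists>\<nu>>0. coercive X (\<lambda>x y. weight a x * (1 / (1 - l2_inner x y)) * cnj (weight a y)) \<nu>"
    by (rule coercive_congruence[OF X(1) co]) (use weight_nonzero a X in auto)
  then obtain \<nu> where "0 < \<nu>" "coercive X (\<lambda>x y. weight a x * (1 / (1 - l2_inner x y)) * cnj (weight a y)) \<nu>"
    by blast
  then show ?thesis
    using coercive_cong[where Q = "\<lambda>x y. 1 / (1 - mobius_gram a x y)"] normalised_kernel_eq[OF a] X(2)
    by (metis (no_types, lifting) subsetD)
qed

text \<open>Rebasing at the new point \<open>a\<close> turns its row into the constant 1, and the Schur complement
  of that entry is the Schur product of the previous kernel with a Gram kernel of positive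
  diagonal.\<close>

lemma coercive_kernel:
  assumes "finite X" "X \<subseteq> l2_ball"
  shows "\<exists>\<mu>>0. coercive X (\<lambda>x y. 1 / (1 - l2_inner x y)) \<mu>"
  using assms
proof (induction X rule: finite_induct)
  case empty
  show ?case by (intro exI[of _ 1]) (simp add: coercive_def herm_form_def)
next
  case (insert a X)
  then have a: "a \<in> l2_ball" and X: "X \<subseteq> l2_ball" by auto
  let ?A = "mobius_gram a"
  let ?P = "\<lambda>x y. 1 / (1 - ?A x y)"
  obtain \<mu> where \<mu>: "0 < \<mu>" "coercive X ?P \<mu>"
    using coercive_normalised_kernel[OF insert(1) X a] insert.IH[OF X] by blast
  define \<nu> where "\<nu> = Min (insert 1 ((\<lambda>x. (pseudohyperbolic x a)\<^sup>2) ` X))"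
  have "0 < (pseudohyperbolic x a)\<^sup>2" if "x \<in> X" for x
    using pseudohyperbolic_less_1(2)[OF a, of x] that X insert(2) by auto
  then have \<nu>: "0 < \<nu>" "\<And>x. x \<in> X \<Longrightarrow> \<nu> \<le> (pseudohyperbolic x a)\<^sup>2"
    unfolding \<nu>_def using insert(1) by (auto intro!: Min_le)
  have "coercive X (\<lambda>x y. ?A x y * ?P x y) (\<mu> * \<nu>)"
    by (rule coercive_schur[OF insert(1) schur_positive_mobius_gram[OF a X] \<mu>(2) mobius_gram_diagonal[OF a]])
      (use X \<nu> \<mu> in auto)
  \<comment> \<open>The cut-off changes nothing on \<open>X\<close>, as \<open>a\<close> is not in
    \<open>X\<close>. It makes the row and the column of \<open>a\<close> vanish for all indices,
    even those outside the ball.\<close>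
  then have "coercive X (\<lambda>x y. if x \<noteq> a \<and> y \<noteq> a then ?A x y * ?P x y else 0) (\<mu> * \<nu>)"
    by (rule coercive_cong) (use insert(2) in auto)
  then have "\<exists>\<nu>>0. coercive (insert a X) (\<lambda>x y. 1 + (if x \<noteq> a \<and> y \<noteq> a then ?A x y * ?P x y else 0)) \<nu>"
    by (rule coercive_insert[OF insert(1,2)]) (use \<mu> \<nu> in auto)
  then obtain \<nu>' where \<nu>': "0 < \<nu>'"
    "coercive (insert a X) (\<lambda>x y. 1 + (if x \<noteq> a \<and> y \<noteq> a then ?A x y * ?P x y else 0)) \<nu>'"
    by blast
  \<comment> \<open>Here \<open>1 + A / (1 - A) = 1 / (1 - A)\<close>, and in the row and the column
    of \<open>a\<close> both sides are 1.\<close>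
  have "coercive (insert a X) ?P \<nu>'"
  proof (rule coercive_cong[OF \<nu>'(2)])
    fix x y assume xy: "x \<in> insert a X" "y \<in> insert a X"
    then have "?A x y \<noteq> 1" using cmod_mobius_gram_less_1[OF a, of x y] insert.prems by fastforce
    moreover have "?A x y = 0" if "x = a \<or> y = a"
      using that xy mobius_gram_base[OF a] insert.prems by auto
    ultimately show "1 + (if x \<noteq> a \<and> y \<noteq> a then ?A x y * ?P x y else 0) = ?P x y"
      by (auto simp: divide_simps)
  qed
  \<comment> \<open>Dividing by the weights undoes the normalisation at \<open>a\<close>.\<close>
  then have "\<exists>\<nu>>0. coercive (insert a X) (\<lambda>x y. (1 / weight a x) * ?P x y * cnj (1 / weight a y)) \<nu>"
    by (rule coercive_congruence[OF _ _ \<nu>'(1), rotated])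
      (use insert weight_nonzero[OF a] in auto)
  then obtain \<kappa> where \<kappa>: "0 < \<kappa>" "coercive (insert a X) (\<lambda>x y. (1 / weight a x) * ?P x y * cnj (1 / weight a y)) \<kappa>"
    by blast
  have "coercive (insert a X) (\<lambda>x y. 1 / (1 - l2_inner x y)) \<kappa>"
  proof (rule coercive_cong[OF \<kappa>(2)])
    fix x y assume "x \<in> insert a X" "y \<in> insert a X"
    then have xy: "x \<in> l2_ball" "y \<in> l2_ball" using insert.prems by auto
    show "(1 / weight a x) * ?P x y * cnj (1 / weight a y) = 1 / (1 - l2_inner x y)"
      unfolding normalised_kernel_eq[OF a xy] using weight_nonzero[OF a] xy by simp
  qed
  then show ?case using \<kappa>(1) by blast
qed

section \<open>Kernel expansions\<close>

context rkhs
begin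

lemma sum_mem:
  "finite S \<Longrightarrow> (\<And>s. s \<in> S \<Longrightarrow> f s \<in> funs H) \<Longrightarrow> (\<lambda>x. \<Sum>s\<in>S. c s * f s x) \<in> funs H"
  by (induction S rule: finite_induct) (auto simp: zero_mem intro!: add_mem scale_mem)

lemma diff_mem: "f \<in> funs H \<Longrightarrow> g \<in> funs H \<Longrightarrow> (\<lambda>x. f x - g x) \<in> funs H"
  using add_mem[OF _ scale_mem[of g "-1"], of f] by simp

lemma ip_zero_left: "g \<in> funs H \<Longrightarrow> ip H (\<lambda>x. 0) g = 0"
  using ip_scale_left[OF zero_mem, of g 0] by simp

lemma ip_sum_left:
  "finite S \<Longrightarrow> (\<And>s. s \<in> S \<Longrightarrow> f s \<in> funs H) \<Longrightarrow> g \<in> funs H \<Longrightarrow>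
    ip H (\<lambda>x. \<Sum>s\<in>S. c s * f s x) g = (\<Sum>s\<in>S. c s * ip H (f s) g)"
  by (induction S rule: finite_induct)
    (auto simp: ip_zero_left ip_add_left ip_scale_left scale_mem sum_mem)

lemma ip_diff_left:
  assumes "f \<in> funs H" "g \<in> funs H" "h \<in> funs H"
  shows "ip H (\<lambda>x. f x - g x) h = ip H f h - ip H g h"
  using ip_add_left[OF assms(1) scale_mem[OF assms(2), of "-1"] assms(3)]
    ip_scale_left[OF assms(2,3), of "-1"] by simp

lemma ip_nonneg: "f \<in> funs H \<Longrightarrow> 0 \<le> Re (ip H f f)"
  using ip_pos[of f] ip_zero_left[OF zero_mem] by (cases "f = (\<lambda>x. 0)") auto

lemma fnorm_power2: "f \<in> funs H \<Longrightarrow> (fnorm H f)\<^sup>2 = Re (ip H f f)"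
  by (simp add: fnorm_def ip_nonneg)

lemma fnorm_nonneg: "f \<in> funs H \<Longrightarrow> 0 \<le> fnorm H f"
  by (simp add: fnorm_def ip_nonneg)

lemma fnorm_zero: "fnorm H (\<lambda>x. 0) = 0"
  by (simp add: fnorm_def ip_zero_left zero_mem)

lemma fnorm_scale_power2:
  assumes "f \<in> funs H"
  shows "(fnorm H (\<lambda>x. c * f x))\<^sup>2 = (cmod c)\<^sup>2 * (fnorm H f)\<^sup>2"
proof -
  have "ip H (\<lambda>x. c * f x) (\<lambda>x. c * f x) = c * cnj c * ip H f f"
    using assms ip_commute[OF assms scale_mem[OF assms, of c]] ip_commute[OF assms assms]
    by (simp add: ip_scale_left scale_mem)
  also have "c * cnj c = complex_of_real ((cmod c)\<^sup>2)" by (rule complex_norm_square[symmetric])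
  finally show ?thesis using assms by (simp add: fnorm_power2 scale_mem del: of_real_power)
qed

text \<open>Positivity of the squared norm of \<open>f - g\<close>. This is used in place of
  Cauchy-Schwarz, with vectors scaled so that no constant is lost.\<close>

lemma Re_ip_le:
  assumes "f \<in> funs H" "g \<in> funs H"
  shows "2 * Re (ip H f g) \<le> (fnorm H f)\<^sup>2 + (fnorm H g)\<^sup>2"
proof -
  have d: "(\<lambda>x. f x - g x) \<in> funs H" by (rule diff_mem[OF assms])
  have "0 \<le> Re (ip H (\<lambda>x. f x - g x) (\<lambda>x. f x - g x))" by (rule ip_nonneg[OF d])
  also have "ip H (\<lambda>x. f x - g x) (\<lambda>x. f x - g x) =
      cnj (ip H f f - ip H g f) - cnj (ip H f g - ip H g g)"
    using assms d by (simp add: ip_diff_left ip_commute[OF _ d])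
  finally show ?thesis
    using arg_cong[OF ip_commute[OF assms], of Re] assms by (simp add: fnorm_power2)
qed

definition expansion :: "('x \<Rightarrow> complex) \<Rightarrow> 'x set \<Rightarrow> 'x \<Rightarrow> complex" where
  "expansion c S = (\<lambda>z. \<Sum>x\<in>S. c x * kernel_fun H x z)"

lemma expansion_mem: "finite S \<Longrightarrow> S \<subseteq> points H \<Longrightarrow> expansion c S \<in> funs H"
  unfolding expansion_def by (intro sum_mem kernel_mem) auto

lemma ip_expansion:
  assumes "finite S" "S \<subseteq> points H" "f \<in> funs H"
  shows "ip H f (expansion c S) = (\<Sum>x\<in>S. cnj (c x) * f x)"
proof -
  have "ip H f (expansion c S) = cnj (ip H (expansion c S) f)"
    by (rule ip_commute[OF assms(3) expansion_mem[OF assms(1,2)]])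
  also have "ip H (expansion c S) f = (\<Sum>x\<in>S. c x * ip H (kernel_fun H x) f)"
    unfolding expansion_def using assms by (intro ip_sum_left kernel_mem) auto
  also have "cnj \<dots> = (\<Sum>x\<in>S. cnj (c x) * f x)"
    unfolding cnj_sum using assms ip_commute[OF assms(3) kernel_mem]
    by (intro sum.cong) (auto simp: reproducing subset_iff)
  finally show ?thesis .
qed

lemma fnorm_expansion:
  assumes "finite S" "S \<subseteq> points H"
  shows "(fnorm H (expansion c S))\<^sup>2 = herm_form S (\<lambda>x y. kernel_fun H y x) c"
proof -
  have "(\<Sum>y\<in>S. cnj (c y) * expansion c S y) = (\<Sum>y\<in>S. \<Sum>x\<in>S. c x * cnj (c y) * kernel_fun H x y)"
    by (simp add: expansion_def sum_distrib_left mult_ac)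
  also have "\<dots> = (\<Sum>x\<in>S. \<Sum>y\<in>S. c x * cnj (c y) * kernel_fun H x y)"
    by (rule sum.swap)
  finally show ?thesis
    unfolding fnorm_power2[OF expansion_mem[OF assms]] ip_expansion[OF assms expansion_mem[OF assms]]
    by (simp only: herm_form_def)
qed

end

text \<open>Inductive interpolation: the new kernel function minus its interpolant on
  \<open>S\<close> is a function \<open>p\<close> vanishing on \<open>S\<close>, and it corrects the
  old dual functions at \<open>z\<close>. If \<open>p z\<close> were 0, then \<open>p\<close> would
  be orthogonal to itself and coercivity would kill all its coefficients, although the one at
  \<open>z\<close> is 1.\<close>

lemma (in rkhs) dual_basis:
  assumes "finite S" "S \<subseteq> points H"
    and co: "coercive (points H) (\<lambda>x y. kernel_fun H y x) \<mu>" "0 < \<mu>" "finite (points H)"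
  shows "\<forall>x\<in>S. \<exists>c. \<forall>y\<in>S. expansion c S y = (if x = y then 1 else 0)"
  using assms(1,2)
proof (induction S rule: finite_induct)
  case empty
  show ?case by simp
next
  case (insert z S)
  then have S: "finite S" "S \<subseteq> points H" "z \<in> points H" by auto
  obtain c where c: "\<And>x y. x \<in> S \<Longrightarrow> y \<in> S \<Longrightarrow> expansion (c x) S y = (if x = y then 1 else 0)"
    using insert.IH[OF S(2)] by metis
  have exp_insert: "expansion (\<lambda>y. if y = z then t else c y) (insert z S) = (\<lambda>w. t * kernel_fun H z w + expansion c S w)" for t c
    using insert(1,2) unfolding expansion_def by (intro ext) (auto intro!: sum.cong)
  have lin: "(\<Sum>x\<in>S. g x * expansion (c x) S w) = expansion (\<lambda>y. \<Sum>x\<in>S. g x * c x y) S w" for g w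
    unfolding expansion_def sum_distrib_left sum_distrib_right
    by (subst sum.swap) (simp add: mult.assoc)
  define e where "e = (\<lambda>y. if y = z then 1 else - (\<Sum>x\<in>S. kernel_fun H z x * c x y))"
  define p where "p = expansion e (insert z S)"
  have p: "p w = kernel_fun H z w - (\<Sum>x\<in>S. kernel_fun H z x * expansion (c x) S w)" for w
    unfolding p_def e_def exp_insert[of 1 "\<lambda>y. - (\<Sum>x\<in>S. kernel_fun H z x * c x y)"] lin
    by (simp add: expansion_def sum_negf)
  have p0: "p w = 0" if "w \<in> S" for w
  proof -
    have "(\<Sum>x\<in>S. kernel_fun H z x * expansion (c x) S w) = (\<Sum>x\<in>S. if x = w then kernel_fun H z x else 0)"
      using that c by (intro sum.cong) auto
    then show ?thesis unfolding p using that S(1) by simp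
  qed
  have fin: "finite (insert z S)" "insert z S \<subseteq> points H" using S by auto
  have pz: "p z \<noteq> 0"
  proof
    assume "p z = 0"
    \<comment> \<open>Coercivity speaks of all points, so the coefficients are extended by
      0.\<close>
    define v where "v = (\<lambda>y. if y \<in> insert z S then e y else 0)"
    have "p = expansion v (points H)"
      unfolding p_def expansion_def v_def using fin co(3)
      by (intro ext sum.mono_neutral_cong_left) auto
    moreover have "p \<in> funs H" unfolding p_def by (rule expansion_mem[OF fin])
    moreover have "ip H p p = 0"
      using ip_expansion[OF fin \<open>p \<in> funs H\<close>, of e, folded p_def] p0 \<open>p z = 0\<close>
      by (auto intro: sum.neutral)
    ultimately have "herm_form (points H) (\<lambda>x y. kernel_fun H y x) v = 0"
      using fnorm_expansion[OF co(3) order_refl, of v] fnorm_power2[of p] by simp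
    then have "v z = 0" by (rule coercive_zeroD[OF co(3,1,2) _ S(3)])
    then show False by (simp add: v_def e_def)
  qed
  have scale: "t * expansion f T w = expansion (\<lambda>y. t * f y) T w" for t f T w
    unfolding expansion_def by (simp add: sum_distrib_left mult.assoc)
  have add: "expansion f T w + expansion g T w = expansion (\<lambda>y. f y + g y) T w" for f g T w
    unfolding expansion_def by (simp add: sum.distrib ring_distribs)
  show ?case
  proof
    fix x assume x: "x \<in> insert z S"
    show "\<exists>c. \<forall>y\<in>insert z S. expansion c (insert z S) y = (if x = y then 1 else 0)"
    proof (cases "x = z")
      case True
      then have "(1 / p z) * p w = (if x = w then 1 else 0)" if "w \<in> insert z S" for w
        using that p0[of w] pz insert(2) by auto
      then show ?thesis
        unfolding p_def scale by blast
    next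
      case False
      define f where "f = expansion (\<lambda>y. if y = z then 0 else c x y) (insert z S)"
      have f: "f w = expansion (c x) S w" for w
        unfolding f_def exp_insert by simp
      define t where "t = - f z / p z"
      have "f w + t * p w = (if x = w then 1 else 0)" if "w \<in> insert z S" for w
      proof (cases "w = z")
        case True
        then show ?thesis using pz False by (simp add: t_def)
      next
        case w: False
        then show ?thesis using that p0[of w] c[of x w] x False by (simp add: f)
      qed
      then show ?thesis
        unfolding f_def p_def scale add by blast
    qed
  qed
qed

section \<open>RKHSs on finite sets with strictly positive Gram matrix\<close>

text \<open>Strict positivity makes the kernel functions a basis of all functions on the finite set.
  Every function on the points then lies in the space and is a multiplier, so membership is never an
  issue for rows of multipliers.\<close>

locale finite_rkhs = rkhs +
  assumes finite_points: "finite (points H)"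
    and strictly_positive: "\<exists>\<mu>>0. coercive (points H) (\<lambda>x y. kernel_fun H y x) \<mu>"
begin

lemma spanned_by_kernels:
  assumes f: "\<And>x. x \<notin> points H \<Longrightarrow> f x = 0"
  shows "\<exists>c. f = expansion c (points H)"
proof -
  obtain c where c: "\<And>x y. x \<in> points H \<Longrightarrow> y \<in> points H \<Longrightarrow>
      expansion (c x) (points H) y = (if x = y then 1 else 0)"
    using dual_basis[OF finite_points order_refl _ _ finite_points] strictly_positive by metis
  define e where "e = (\<lambda>y. \<Sum>x\<in>points H. f x * c x y)"
  have "expansion e (points H) w = (\<Sum>x\<in>points H. f x * expansion (c x) (points H) w)" for w
    unfolding expansion_def e_def sum_distrib_left sum_distrib_right
    by (subst sum.swap) (simp add: mult.assoc)
  moreover have "(\<Sum>x\<in>points H. f x * expansion (c x) (points H) w) = (\<Sum>x\<in>points H. if x = w then f x else 0)"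
    if "w \<in> points H" for w
    using that c by (intro sum.cong) auto
  ultimately have "expansion e (points H) w = f w" if "w \<in> points H" for w
    using that finite_points by simp
  moreover have "expansion e (points H) w = f w" if "w \<notin> points H" for w
    using that f zero_outside[OF expansion_mem[OF finite_points order_refl]] by simp
  ultimately show ?thesis by (intro exI[of _ e] ext) metis
qed

lemma funs_eq: "funs H = {f. \<forall>x. x \<notin> points H \<longrightarrow> f x = 0}"
  using spanned_by_kernels expansion_mem[OF finite_points order_refl] zero_outside by blast

lemma funsE:
  assumes "f \<in> funs H"
  obtains c where "f = expansion c (points H)"
  using spanned_by_kernels zero_outside assms by blast

lemma Mult_eq: "Mult H = {f. \<forall>x. x \<notin> points H \<longrightarrow> f x = 0}"
  unfolding Mult_def funs_eq by auto

lemma expansion_inj: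
  assumes eq: "expansion c (points H) = expansion d (points H)" and x: "x \<in> points H"
  shows "c x = d x"
proof -
  let ?v = "\<lambda>y. c y - d y"
  have "expansion ?v (points H) = (\<lambda>w. expansion c (points H) w - expansion d (points H) w)"
    by (simp add: expansion_def sum_subtractf left_diff_distrib)
  then have "expansion ?v (points H) = (\<lambda>w. 0)" by (simp add: eq)
  then have "herm_form (points H) (\<lambda>x y. kernel_fun H y x) ?v = 0"
    using fnorm_expansion[OF finite_points order_refl, of ?v] fnorm_zero by simp
  with strictly_positive show ?thesis
    using coercive_zeroD[OF finite_points, where v = ?v and x = x] x by fastforce
qed

end

lemma drury_arveson_finite_rkhs:
  assumes "is_drury_arveson_on X H" "finite X" "X \<subseteq> l2_ball"
  shows "finite_rkhs H"
proof -
  have H: "rkhs H" "points H = X" "\<And>z w. z \<in> X \<Longrightarrow> w \<in> X \<Longrightarrow> kernel_fun H w z = 1 / (1 - l2_inner z w)"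
    using assms(1) unfolding is_drury_arveson_on_def by auto
  obtain \<mu> where \<mu>: "\<mu> > 0" "coercive X (\<lambda>x y. 1 / (1 - l2_inner x y)) \<mu>"
    using coercive_kernel[OF assms(2,3)] by blast
  have "coercive X (\<lambda>x y. kernel_fun H y x) \<mu>"
    by (rule coercive_cong[OF \<mu>(2)]) (simp add: H(3))
  then show ?thesis
    using H(1,2) assms(2) \<mu>(1)
    by (auto simp: finite_rkhs_def finite_rkhs_axioms_def)
qed

lemma (in finite_rkhs) Re_kernel_pos:
  assumes "y \<in> points H"
  shows "0 < Re (kernel_fun H y y)"
proof -
  obtain \<mu> where \<mu>: "\<mu> > 0" "coercive (points H) (\<lambda>x y. kernel_fun H y x) \<mu>"
    using strictly_positive by blast
  let ?\<delta> = "\<lambda>x. if x = y then 1 else (0::complex)"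
  have "(\<Sum>x\<in>points H. (cmod (?\<delta> x))\<^sup>2) = (\<Sum>x\<in>points H. if x = y then 1 else 0)"
    by (intro sum.cong) auto
  also have "\<dots> = 1" using assms finite_points by simp
  finally have "\<mu> * 1 \<le> herm_form (points H) (\<lambda>x y. kernel_fun H y x) ?\<delta>"
    using \<mu>(2) unfolding coercive_def by metis
  then show ?thesis using \<mu>(1) assms finite_points by (simp add: herm_form_delta)
qed

lemma (in rkhs) psd_kernel: "finite (points H) \<Longrightarrow> psd (points H) (\<lambda>x y. kernel_fun H y x)"
  unfolding psd_def by (metis fnorm_expansion order_refl zero_le_power2)

section \<open>Rows of multipliers\<close>

context rkhs
begin

text \<open>The adjoint of the row \<open>b\<close> sends the kernel function at \<open>x\<close> to
  the column with entries \<open>cnj (b l x)\<close> times that kernel function. The pairing states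
  this without introducing adjoint operators.\<close>

lemma row_pairing:
  assumes "finite (points H)" and h: "\<And>l. l < m \<Longrightarrow> h l \<in> funs H"
    and f: "(\<lambda>x. \<Sum>l<m. b l x * h l x) \<in> funs H"
  shows "ip H (\<lambda>x. \<Sum>l<m. b l x * h l x) (expansion c (points H)) =
    (\<Sum>l<m. ip H (h l) (expansion (\<lambda>x. c x * cnj (b l x)) (points H)))"
proof -
  have "ip H (\<lambda>x. \<Sum>l<m. b l x * h l x) (expansion c (points H)) =
      (\<Sum>x\<in>points H. \<Sum>l<m. cnj (c x * cnj (b l x)) * h l x)"
    by (simp add: ip_expansion[OF assms(1) order_refl f] sum_distrib_left mult.assoc)
  also have "\<dots> = (\<Sum>l<m. \<Sum>x\<in>points H. cnj (c x * cnj (b l x)) * h l x)"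
    by (rule sum.swap)
  also have "\<dots> = (\<Sum>l<m. ip H (h l) (expansion (\<lambda>x. c x * cnj (b l x)) (points H)))"
    using h by (intro sum.cong) (auto simp: ip_expansion[OF assms(1) order_refl])
  finally show ?thesis .
qed

text \<open>The squared norm of the adjoint row applied to the expansion with coefficients
  \<open>c\<close>.\<close>

lemma sum_fnorm_expansion:
  assumes "finite (points H)"
  shows "(\<Sum>l<m. (fnorm H (expansion (\<lambda>x. c x * cnj (b l x)) (points H)))\<^sup>2) =
    herm_form (points H) (\<lambda>x y. (\<Sum>l<m. b l x * cnj (b l y)) * kernel_fun H y x) c"
proof -
  have "herm_form (points H) (\<lambda>x y. (\<Sum>l<m. b l x * cnj (b l y)) * kernel_fun H y x) c =
      herm_form (points H) (\<lambda>x y. \<Sum>l<m. b l x * kernel_fun H y x * cnj (b l y)) c"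
    by (intro herm_form_cong refl) (simp add: sum_distrib_left mult_ac)
  then show ?thesis
    by (simp add: fnorm_expansion[OF assms order_refl] herm_form_sum herm_form_congruence)
qed

text \<open>A row bounded by \<open>a\<close> has an adjoint bounded by \<open>a\<close>, and on
  combinations of kernel functions this is the claimed positivity. The bound is tested on
  \<open>u\<close>, the image of the combination under the adjoint.\<close>

lemma psd_of_row_bound:
  assumes fin: "finite (points H)" and a: "0 < a"
    and mem: "\<And>h. (\<And>l. l < m \<Longrightarrow> h l \<in> funs H) \<Longrightarrow> (\<lambda>x. \<Sum>l<m. b l x * h l x) \<in> funs H"
    and bound: "\<And>h. (\<And>l. l < m \<Longrightarrow> h l \<in> funs H) \<Longrightarrow>
      (fnorm H (\<lambda>x. \<Sum>l<m. b l x * h l x))\<^sup>2 \<le> a\<^sup>2 * (\<Sum>l<m. (fnorm H (h l))\<^sup>2)"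
  shows "psd (points H) (\<lambda>x y. (of_real (a\<^sup>2) - (\<Sum>l<m. b l x * cnj (b l y))) * kernel_fun H y x)"
  unfolding psd_def
proof
  fix c
  define u where "u l = expansion (\<lambda>x. c x * cnj (b l x)) (points H)" for l
  define U where "U = (\<Sum>l<m. (fnorm H (u l))\<^sup>2)"
  define f where "f = (\<lambda>x. \<Sum>l<m. b l x * u l x)"
  let ?K = "\<lambda>x y. kernel_fun H y x"
  \<comment> \<open>The scaling by \<open>a ^ 2\<close> balances the two squares in
    \<open>Re_ip_le\<close>, so that the constant comes out exactly.\<close>
  let ?g = "expansion (\<lambda>x. of_real (a\<^sup>2) * c x) (points H)"
  have u: "u l \<in> funs H" for l unfolding u_def by (rule expansion_mem[OF fin order_refl])
  have f: "f \<in> funs H" unfolding f_def by (rule mem) (rule u)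
  have "ip H f (expansion c (points H)) = (\<Sum>l<m. ip H (u l) (u l))"
    using row_pairing[OF fin u f[unfolded f_def], of c] unfolding f_def u_def .
  then have "Re (ip H f (expansion c (points H))) = U"
    using u by (simp add: U_def fnorm_power2)
  moreover have "ip H f ?g = of_real (a\<^sup>2) * ip H f (expansion c (points H))"
    by (simp add: ip_expansion[OF fin order_refl f] sum_distrib_left mult.assoc)
  ultimately have re: "Re (ip H f ?g) = a\<^sup>2 * U" by simp
  have norm: "(fnorm H ?g)\<^sup>2 = a\<^sup>2 * a\<^sup>2 * herm_form (points H) ?K c"
  proof -
    have "?g = (\<lambda>x. of_real (a\<^sup>2) * expansion c (points H) x)"
      unfolding expansion_def by (simp add: sum_distrib_left mult.assoc)
    then have "(fnorm H ?g)\<^sup>2 = (cmod (of_real (a\<^sup>2)))\<^sup>2 * (fnorm H (expansion c (points H)))\<^sup>2"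
      by (simp only: fnorm_scale_power2[OF expansion_mem[OF fin order_refl]])
    then show ?thesis
      by (simp only: norm_of_real abs_power2 fnorm_expansion[OF fin order_refl] power2_eq_square[of "a\<^sup>2"])
  qed
  have "(fnorm H f)\<^sup>2 \<le> a\<^sup>2 * U"
    unfolding f_def U_def by (rule bound) (rule u)
  moreover have "2 * (a\<^sup>2 * U) \<le> (fnorm H f)\<^sup>2 + a\<^sup>2 * a\<^sup>2 * herm_form (points H) ?K c"
    using Re_ip_le[OF f expansion_mem[OF fin order_refl, of "\<lambda>x. of_real (a\<^sup>2) * c x"]]
    unfolding re norm .
  ultimately have "a\<^sup>2 * U \<le> a\<^sup>2 * (a\<^sup>2 * herm_form (points H) ?K c)"
    unfolding mult.assoc by linarith
  then have "U \<le> a\<^sup>2 * herm_form (points H) ?K c"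
    by (rule mult_left_le_imp_le) (use a in simp)
  then show "0 \<le> herm_form (points H) (\<lambda>x y. (of_real (a\<^sup>2) - (\<Sum>l<m. b l x * cnj (b l y))) * kernel_fun H y x) c"
    unfolding U_def u_def sum_fnorm_expansion[OF fin] left_diff_distrib herm_form_diff herm_form_scale by simp
qed

text \<open>Normalising \<open>h\<close> makes it admissible in the supremum, and of the image only
  component 0 is kept. A zero column cannot be normalised and is treated apart.\<close>

lemma row_bound_of_mult_matrix_norm:
  assumes "mult_matrix_norm H m A \<le> ennreal a" "0 \<le> a" "0 < m"
    and h: "\<And>l. l < m \<Longrightarrow> h l \<in> funs H"
    and mem: "\<And>h i. (\<And>l. l < m \<Longrightarrow> h l \<in> funs H) \<Longrightarrow> (\<lambda>x. \<Sum>l<m. A i l x * h l x) \<in> funs H"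
  shows "(fnorm H (\<lambda>x. \<Sum>l<m. A 0 l x * h l x))\<^sup>2 \<le> a\<^sup>2 * (\<Sum>l<m. (fnorm H (h l))\<^sup>2)"
proof -
  define S where "S = (\<Sum>l<m. (fnorm H (h l))\<^sup>2)"
  have S: "0 \<le> S" unfolding S_def by (simp add: sum_nonneg)
  show ?thesis
  proof (cases "S = 0")
    case True
    then have "fnorm H (h l) = 0" if "l < m" for l
      using that unfolding S_def by (auto simp: sum_nonneg_eq_0_iff)
    then have "h l = (\<lambda>x. 0)" if "l < m" for l
      using that h[OF that] ip_pos[OF h[OF that]] fnorm_power2[OF h[OF that]] by fastforce
    then have "(\<lambda>x. \<Sum>l<m. A 0 l x * h l x) = (\<lambda>x. 0)" by simp
    then show ?thesis using S by (simp add: fnorm_zero S_def[symmetric])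
  next
    case False
    define t where "t = complex_of_real (1 / sqrt S)"
    have t: "(cmod t)\<^sup>2 * S = 1" using False S by (simp add: t_def power_divide norm_divide)
    define h' where "h' l = (\<lambda>x. t * h l x)" for l
    have h': "h' l \<in> funs H" if "l < m" for l unfolding h'_def by (rule scale_mem[OF h[OF that]])
    have row: "(\<lambda>x. \<Sum>l<m. A i l x * h' l x) = (\<lambda>x. t * (\<Sum>l<m. A i l x * h l x))" for i
      unfolding h'_def by (simp add: sum_distrib_left mult_ac)
    have "(\<Sum>j<m. (fnorm H (h' j))\<^sup>2) = 1"
      using h t by (simp add: h'_def fnorm_scale_power2 sum_distrib_left[symmetric] S_def)
    then have "ennreal (sqrt (\<Sum>i<m. (fnorm H (\<lambda>x. \<Sum>j<m. A i j x * h' j x))\<^sup>2)) \<le> mult_matrix_norm H m A"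
      unfolding mult_matrix_norm_def using h' by (intro SUP_upper) auto
    also have "\<dots> \<le> ennreal a" by (rule assms(1))
    finally have "sqrt (\<Sum>i<m. (fnorm H (\<lambda>x. \<Sum>j<m. A i j x * h' j x))\<^sup>2) \<le> a"
      using assms(2) by simp
    then have "(\<Sum>i<m. (fnorm H (\<lambda>x. \<Sum>j<m. A i j x * h' j x))\<^sup>2) \<le> a\<^sup>2"
      by (rule sqrt_le_D)
    moreover have "(fnorm H (\<lambda>x. \<Sum>j<m. A 0 j x * h' j x))\<^sup>2 \<le> (\<Sum>i<m. (fnorm H (\<lambda>x. \<Sum>j<m. A i j x * h' j x))\<^sup>2)"
      using assms(3) by (intro member_le_sum[where f = "\<lambda>i. (fnorm H (\<lambda>x. \<Sum>j<m. A i j x * h' j x))\<^sup>2"]) auto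
    ultimately have "(cmod t)\<^sup>2 * (fnorm H (\<lambda>x. \<Sum>l<m. A 0 l x * h l x))\<^sup>2 \<le> a\<^sup>2"
      unfolding row using fnorm_scale_power2[OF mem[OF h]] by simp
    then have "S * ((cmod t)\<^sup>2 * (fnorm H (\<lambda>x. \<Sum>l<m. A 0 l x * h l x))\<^sup>2) \<le> S * a\<^sup>2"
      using S by (rule mult_left_mono)
    then have "((cmod t)\<^sup>2 * S) * (fnorm H (\<lambda>x. \<Sum>l<m. A 0 l x * h l x))\<^sup>2 \<le> a\<^sup>2 * S"
      by (simp only: mult_ac)
    then show ?thesis by (simp only: t S_def[symmetric] mult_1_left)
  qed
qed

end

context finite_rkhs
begin

lemma row_mem:
  assumes "\<And>l. l < m \<Longrightarrow> h l \<in> funs H"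
  shows "(\<lambda>x. \<Sum>l<m. b l x * h l x) \<in> funs H"
  using assms by (simp add: funs_eq)

text \<open>The converse for bound 1. The image \<open>f\<close> of \<open>h\<close> is itself a
  combination of kernel functions, its squared norm is the pairing of \<open>h\<close> with the
  adjoint row applied to \<open>f\<close>, and by positivity that column is no longer than
  \<open>f\<close>.\<close>

lemma row_bound_of_psd:
  assumes psd: "psd (points H) (\<lambda>x y. (1 - (\<Sum>l<m. b l x * cnj (b l y))) * kernel_fun H y x)"
    and h: "\<And>l. l < m \<Longrightarrow> h l \<in> funs H"
  shows "(fnorm H (\<lambda>x. \<Sum>l<m. b l x * h l x))\<^sup>2 \<le> (\<Sum>l<m. (fnorm H (h l))\<^sup>2)"
proof -
  define f where "f = (\<lambda>x. \<Sum>l<m. b l x * h l x)"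
  have f: "f \<in> funs H" unfolding f_def by (rule row_mem[OF h])
  obtain c where c: "f = expansion c (points H)" using funsE[OF f] .
  define u where "u l = expansion (\<lambda>x. c x * cnj (b l x)) (points H)" for l
  have u: "u l \<in> funs H" for l unfolding u_def by (rule expansion_mem[OF finite_points order_refl])
  have "ip H f f = (\<Sum>l<m. ip H (h l) (u l))"
    using row_pairing[OF finite_points h f[unfolded f_def], where c = c]
    unfolding f_def[symmetric] c[symmetric] u_def .
  then have "2 * (fnorm H f)\<^sup>2 = (\<Sum>l<m. 2 * Re (ip H (h l) (u l)))"
    by (simp add: fnorm_power2[OF f] sum_distrib_left)
  also have "\<dots> \<le> (\<Sum>l<m. (fnorm H (h l))\<^sup>2 + (fnorm H (u l))\<^sup>2)"
    by (intro sum_mono Re_ip_le h u) simp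
  also have "\<dots> = (\<Sum>l<m. (fnorm H (h l))\<^sup>2) + (\<Sum>l<m. (fnorm H (u l))\<^sup>2)"
    by (rule sum.distrib)
  also have "(\<Sum>l<m. (fnorm H (u l))\<^sup>2) \<le> (fnorm H f)\<^sup>2"
    unfolding u_def sum_fnorm_expansion[OF finite_points]
    unfolding c fnorm_expansion[OF finite_points order_refl]
    using psd by (simp add: psd_def left_diff_distrib herm_form_diff)
  finally show ?thesis unfolding f_def by simp
qed

text \<open>\<open>mult_matrix_norm\<close> is about square matrices, so the row is padded with zero
  rows; its entries are cut off outside the points, where multipliers have to vanish.\<close>

lemma mult_matrix_norm_row:
  assumes psd: "psd (points H) (\<lambda>x y. (1 - (\<Sum>l<m. b l x * cnj (b l y))) * kernel_fun H y x)"
    and m: "0 < m" and A: "\<And>i l x. A i l x = (if i = 0 \<and> x \<in> points H then b l x else 0)"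
  shows "mult_matrix_norm H m A \<le> 1"
  unfolding mult_matrix_norm_def
proof (rule SUP_least)
  fix h assume "h \<in> {h. (\<forall>j<m. h j \<in> funs H) \<and> sqrt (\<Sum>j<m. (fnorm H (h j))\<^sup>2) \<le> 1}"
  then have h: "\<And>l. l < m \<Longrightarrow> h l \<in> funs H" and le: "(\<Sum>j<m. (fnorm H (h j))\<^sup>2) \<le> 1"
    by auto
  have row: "(\<lambda>x. \<Sum>j<m. A i j x * h j x) = (if i = 0 then (\<lambda>x. \<Sum>j<m. b j x * h j x) else (\<lambda>x. 0))" for i
    using h by (auto simp: A zero_outside intro!: sum.cong)
  have "(\<Sum>i<m. (fnorm H (\<lambda>x. \<Sum>j<m. A i j x * h j x))\<^sup>2) =
      (\<Sum>i<m. if i = 0 then (fnorm H (\<lambda>x. \<Sum>j<m. b j x * h j x))\<^sup>2 else 0)"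
    unfolding row by (intro sum.cong) (auto simp: fnorm_zero)
  also have "\<dots> = (fnorm H (\<lambda>x. \<Sum>j<m. b j x * h j x))\<^sup>2" using m by simp
  also have "\<dots> \<le> 1" using row_bound_of_psd[OF psd, of h] h le by fastforce
  finally show "ennreal (sqrt (\<Sum>i<m. (fnorm H (\<lambda>x. \<Sum>j<m. A i j x * h j x))\<^sup>2)) \<le> 1"
    by simp
qed

end

section \<open>From completely bounded norms to positive kernels\<close>

text \<open>Positivity on \<open>H\<close> says that the row \<open>b\<close> is a contraction. Its
  image under \<open>\<psi>\<close> has norm at most \<open>a\<close> by the definition of the cb
  norm, which on kernel functions is positivity on \<open>K\<close>.\<close>

lemma cb_norm_psd_transfer:
  fixes H :: "'a function_space"
  assumes H: "finite_rkhs H" and K: "finite_rkhs K"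
    and G: "\<And>y. y \<in> points K \<Longrightarrow> G y \<in> points H"
    and \<psi>: "\<And>f y. f \<in> Mult H \<Longrightarrow> y \<in> points K \<Longrightarrow> \<psi> f y = f (G y)"
    and cb: "cb_norm H K \<psi> \<le> ennreal a" "0 < a" and m: "0 < m"
    and psd: "psd (points H) (\<lambda>x y. (1 - (\<Sum>l<(m::nat). b l x * cnj (b l y))) * kernel_fun H y x)"
  shows "psd (points K) (\<lambda>x y. (of_real (a\<^sup>2) - (\<Sum>l<m. b l (G x) * cnj (b l (G y)))) * kernel_fun K y x)"
proof -
  interpret H: finite_rkhs H by (rule H)
  interpret K: finite_rkhs K by (rule K)
  define A :: "nat \<Rightarrow> nat \<Rightarrow> 'a \<Rightarrow> complex"
    where "A i l x = (if i = 0 \<and> x \<in> points H then b l x else 0)" for i l x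
  have AM: "A i l \<in> Mult H" for i l by (simp add: H.Mult_eq A_def)
  have "mult_matrix_norm H m A \<le> 1"
    by (rule H.mult_matrix_norm_row[OF psd m A_def])
  then have "mult_matrix_norm K m (\<lambda>i j. \<psi> (A i j)) \<le> cb_norm H K \<psi>"
    unfolding cb_norm_def using m AM by (intro SUP_upper2[of m] SUP_upper) auto
  also note cb(1)
  finally have norm: "mult_matrix_norm K m (\<lambda>i j. \<psi> (A i j)) \<le> ennreal a" .
  show ?thesis
  proof (rule K.psd_of_row_bound[OF K.finite_points cb(2) K.row_mem])
    fix h assume h: "\<And>l. l < m \<Longrightarrow> h l \<in> funs K"
    have "(fnorm K (\<lambda>x. \<Sum>l<m. \<psi> (A 0 l) x * h l x))\<^sup>2 \<le> a\<^sup>2 * (\<Sum>l<m. (fnorm K (h l))\<^sup>2)"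
      by (rule K.row_bound_of_mult_matrix_norm[OF norm _ m h K.row_mem]) (use cb(2) in auto)
    moreover have "(\<lambda>x. \<Sum>l<m. \<psi> (A 0 l) x * h l x) = (\<lambda>x. \<Sum>l<m. b l (G x) * h l x)"
    proof (intro ext sum.cong refl)
      fix x l assume "l \<in> {..<m}"
      then show "\<psi> (A 0 l) x * h l x = b l (G x) * h l x"
        using K.zero_outside[OF h] \<psi>[OF AM] G by (cases "x \<in> points K") (auto simp: A_def)
    qed
    ultimately show "(fnorm K (\<lambda>x. \<Sum>l<m. b l (G x) * h l x))\<^sup>2 \<le> a\<^sup>2 * (\<Sum>l<m. (fnorm K (h l))\<^sup>2)"
      by simp
  qed
qed

text \<open>Composition with \<open>G\<close> fixes the constant 1: for the row with the single
  entry 1, a bound below 1 would make a negative multiple of \<open>k(y, y)\<close>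
  nonnegative.\<close>

lemma cb_norm_ge_1:
  fixes H :: "'a function_space"
  assumes H: "finite_rkhs H" and K: "finite_rkhs K"
    and G: "\<And>y. y \<in> points K \<Longrightarrow> G y \<in> points H"
    and \<psi>: "\<And>f y. f \<in> Mult H \<Longrightarrow> y \<in> points K \<Longrightarrow> \<psi> f y = f (G y)"
    and cb: "cb_norm H K \<psi> \<le> ennreal a" "0 \<le> a" and y: "y \<in> points K"
  shows "1 \<le> a"
proof (rule ccontr)
  assume a: "\<not> 1 \<le> a"
  \<comment> \<open>The midpoint is positive even if \<open>a = 0\<close>, as the transfer requires,
    and still below 1.\<close>
  define a' where "a' = (a + 1) / 2"
  have a': "0 < a'" "a' < 1" "a \<le> a'" using a cb(2) by (auto simp: a'_def)
  have "cb_norm H K \<psi> \<le> ennreal a'" using cb(1) a'(3) by (meson ennreal_leI order_trans)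
  then have "psd (points K) (\<lambda>x y. (of_real (a'\<^sup>2) - (\<Sum>l<1::nat. 1 * cnj 1)) * kernel_fun K y x)"
    using cb_norm_psd_transfer[where G = G and \<psi> = \<psi> and a = a' and m = 1 and b = "\<lambda>_ _. 1", OF H K] G \<psi> a'(1)
    by (simp add: psd_def herm_form_def)
  then have "0 \<le> Re ((of_real (a'\<^sup>2) - (\<Sum>l<1::nat. 1 * cnj 1)) * kernel_fun K y y)"
    using psd_diagonal[OF finite_rkhs.finite_points[OF K] _ y] by fast
  then have "0 \<le> (a'\<^sup>2 - 1) * Re (kernel_fun K y y)" by simp
  moreover have "a'\<^sup>2 < 1" using a' by (simp add: power_less_one_iff)
  ultimately show False using finite_rkhs.Re_kernel_pos[OF K y] by (simp add: zero_le_mult_iff)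
qed

text \<open>The coordinates of the automorphism at \<open>x0\<close>, truncated after
  \<open>m\<close> entries, form a row contraction on \<open>X\<close>. The transfer moves each
  truncation to \<open>Y\<close>, the limit restores the full Gram kernel, and the weights at
  \<open>y0\<close> normalise the kernel of \<open>K\<close>.\<close>

lemma cb_norm_mobius_psd:
  assumes H: "is_drury_arveson_on X H" "finite X" "X \<subseteq> l2_ball"
    and K: "is_drury_arveson_on Y K" "finite Y" "Y \<subseteq> l2_ball"
    and G: "\<And>y. y \<in> Y \<Longrightarrow> G y \<in> X"
    and \<psi>: "\<And>f y. f \<in> Mult H \<Longrightarrow> y \<in> Y \<Longrightarrow> \<psi> f y = f (G y)"
    and cb: "cb_norm H K \<psi> \<le> ennreal a" "0 < a" and x0: "x0 \<in> l2_ball" and y0: "y0 \<in> l2_ball"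
  shows "psd Y (\<lambda>x y. (of_real (a\<^sup>2) - mobius_gram x0 (G x) (G y)) * (1 / (1 - mobius_gram y0 x y)))"
proof -
  have fH: "finite_rkhs H" and fK: "finite_rkhs K"
    using drury_arveson_finite_rkhs H K by auto
  interpret H: finite_rkhs H by (rule fH)
  have pH: "points H = X" "\<And>x y. x \<in> X \<Longrightarrow> y \<in> X \<Longrightarrow> kernel_fun H y x = 1 / (1 - l2_inner x y)"
    and pK: "points K = Y" "\<And>x y. x \<in> Y \<Longrightarrow> y \<in> Y \<Longrightarrow> kernel_fun K y x = 1 / (1 - l2_inner x y)"
    using H(1) K(1) unfolding is_drury_arveson_on_def by auto
  define b where "b l x = ball_automorphism x0 x l" for l x
  let ?A = "mobius_gram x0" and ?k = "\<lambda>x y. kernel_fun H y x"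
  have "psd X ?k" using H.psd_kernel[OF H.finite_points] unfolding pH(1) .
  moreover have "schur_positive X (\<lambda>x y. ?A x y - (\<Sum>l<m. b l x * cnj (b l y)))" for m
    unfolding mobius_gram_def b_def
    by (rule schur_positive_l2_tail) (use square_summable_ball_automorphism x0 H(3) in blast)
  ultimately have tail: "psd X (\<lambda>x y. (?A x y - (\<Sum>l<m. b l x * cnj (b l y))) * ?k x y)" for m
    by (rule schur_positiveD[rotated])
  \<comment> \<open>This is \<open>(1 - ?A) * ?k\<close> on \<open>X\<close>, by the normalisation
    identity. The tail kernel adds what the coordinates from \<open>m\<close> on take away.\<close>
  have rank1: "psd X (\<lambda>x y. (1 / weight x0 x) * 1 * cnj (1 / weight x0 y))"
    by (intro psd_congruence psd_one)
  have row: "psd X (\<lambda>x y. (1 - (\<Sum>l<m. b l x * cnj (b l y))) * ?k x y)" for m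
  proof (rule psd_cong[OF psd_add[OF rank1 tail[of m]]])
    fix x y assume xy: "x \<in> X" "y \<in> X"
    then have ball: "x \<in> l2_ball" "y \<in> l2_ball" using H(3) by auto
    have "1 - ?A x y \<noteq> 0" using cmod_mobius_gram_less_1[OF x0 ball] by auto
    moreover have "1 / (1 - ?A x y) = weight x0 x * ?k x y * cnj (weight x0 y)"
      using normalised_kernel_eq[OF x0 ball] pH(2)[OF xy] by simp
    ultimately have e: "(1 - ?A x y) * (weight x0 x * ?k x y * cnj (weight x0 y)) = 1"
      by (metis nonzero_eq_divide_eq mult.commute)
    have "(1 - ?A x y) * ?k x y =
        ((1 - ?A x y) * (weight x0 x * ?k x y * cnj (weight x0 y))) / (weight x0 x * cnj (weight x0 y))"
      using weight_nonzero[OF x0] ball by simp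
    then have "(1 / weight x0 x) * 1 * cnj (1 / weight x0 y) = (1 - ?A x y) * ?k x y"
      unfolding e by simp
    then show "(1 / weight x0 x) * 1 * cnj (1 / weight x0 y) + (?A x y - (\<Sum>l<m. b l x * cnj (b l y))) * ?k x y
        = (1 - (\<Sum>l<m. b l x * cnj (b l y))) * ?k x y"
      by (simp only: left_diff_distrib) simp
  qed
  \<comment> \<open>Rows of length \<open>Suc m\<close>, because the transfer needs a nonempty
    row.\<close>
  have "psd Y (\<lambda>x y. (of_real (a\<^sup>2) - (\<Sum>l<Suc m. b l (G x) * cnj (b l (G y)))) * kernel_fun K y x)" for m
    by (rule cb_norm_psd_transfer[where G = G and \<psi> = \<psi> and a = a and m = "Suc m" and b = b,
          OF fH fK, unfolded pH(1) pK(1)])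
      (use G \<psi> cb row in \<open>auto simp del: sum.lessThan_Suc\<close>)
  then have "psd Y (\<lambda>x y. (of_real (a\<^sup>2) - ?A (G x) (G y)) * kernel_fun K y x)"
  proof (rule psd_LIMSEQ)
    fix x y assume "x \<in> Y" "y \<in> Y"
    then have "square_summable (ball_automorphism x0 (G x))" "square_summable (ball_automorphism x0 (G y))"
      using G H(3) x0 square_summable_ball_automorphism by blast+
    then have "(\<lambda>m. \<Sum>l<Suc m. b l (G x) * cnj (b l (G y))) \<longlonglongrightarrow> ?A (G x) (G y)"
      unfolding b_def mobius_gram_def l2_inner_def
      by (rule LIMSEQ_Suc[OF summable_LIMSEQ[OF summable_l2_inner(2)]])
    then show "(\<lambda>m. (of_real (a\<^sup>2) - (\<Sum>l<Suc m. b l (G x) * cnj (b l (G y)))) * kernel_fun K y x)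
        \<longlonglongrightarrow> (of_real (a\<^sup>2) - ?A (G x) (G y)) * kernel_fun K y x"
      by (intro tendsto_intros)
  qed
  from psd_congruence[OF this, of "weight y0"] show ?thesis
  proof (rule psd_cong)
    fix x y assume xy: "x \<in> Y" "y \<in> Y"
    then have ball: "x \<in> l2_ball" "y \<in> l2_ball" using K(3) by auto
    show "weight y0 x * ((of_real (a\<^sup>2) - ?A (G x) (G y)) * kernel_fun K y x) * cnj (weight y0 y) =
        (of_real (a\<^sup>2) - ?A (G x) (G y)) * (1 / (1 - mobius_gram y0 x y))"
      unfolding normalised_kernel_eq[OF y0 ball] pK(2)[OF xy] by (simp only: mult_ac)
  qed
qed

section \<open>Comparison of normalised kernels\<close>

text \<open>With \<open>P\<close> the full kernel and \<open>T\<close> the remainder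
  \<open>C ^ Suc N / (1 - C)\<close>, the claim \<open>P \<le> (1 + \<epsilon>) * (P - T)\<close>
  amounts to \<open>(1 + \<epsilon>) * T \<le> \<epsilon> * P\<close>. Entrywise smallness of
  \<open>T\<close> and coercivity of \<open>P\<close> give this under the condition on
  \<open>N\<close>.\<close>

lemma geometric_kernel_le_partial_sum:
  assumes I: "finite I" and C: "\<And>x y. x \<in> I \<Longrightarrow> y \<in> I \<Longrightarrow> cmod (C x y) \<le> q" "q < 1"
    and co: "coercive I (\<lambda>x y. 1 / (1 - C x y)) \<mu>" and \<epsilon>: "0 < \<epsilon>"
    and N: "(1 + \<epsilon>) * (real (card I) * (q ^ Suc N / (1 - q))) \<le> \<epsilon> * \<mu>"
  shows "herm_form I (\<lambda>x y. 1 / (1 - C x y)) v \<le> (1 + \<epsilon>) * herm_form I (\<lambda>x y. \<Sum>n\<le>N. C x y ^ n) v"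
proof -
  let ?P = "\<lambda>x y. 1 / (1 - C x y)" and ?S = "\<lambda>x y. \<Sum>n\<le>N. C x y ^ n"
  let ?T = "\<lambda>x y. C x y ^ Suc N / (1 - C x y)" and ?V = "\<Sum>x\<in>I. (cmod (v x))\<^sup>2"
  have "herm_form I ?S v = herm_form I (\<lambda>x y. ?P x y - ?T x y) v"
  proof (intro herm_form_cong refl)
    fix x y assume xy: "x \<in> I" "y \<in> I"
    then have "C x y \<noteq> 1" using C by fastforce
    then show "?S x y = ?P x y - ?T x y"
      using sum_gp0[of "C x y" N] by (simp add: diff_divide_distrib)
  qed
  then have S: "herm_form I ?S v = herm_form I ?P v - herm_form I ?T v"
    by (simp only: herm_form_diff)
  have "\<bar>herm_form I ?T v\<bar> \<le> real (card I) * (q ^ Suc N / (1 - q)) * ?V"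
  proof (rule abs_herm_form_le[OF I])
    fix x y assume xy: "x \<in> I" "y \<in> I"
    have "0 \<le> q" using C(1)[OF xy] norm_ge_zero order_trans by blast
    moreover have "1 - q \<le> cmod (1 - C x y)"
      using norm_triangle_ineq2[of 1 "C x y"] C(1)[OF xy] by simp
    ultimately show "cmod (?T x y) \<le> q ^ Suc N / (1 - q)"
      unfolding norm_divide norm_power using C(1)[OF xy] C(2) by (intro frac_le power_mono) auto
  qed
  then have "(1 + \<epsilon>) * herm_form I ?T v \<le> (1 + \<epsilon>) * (real (card I) * (q ^ Suc N / (1 - q)) * ?V)"
    using \<epsilon> by (intro mult_left_mono) auto
  also have "\<dots> \<le> (\<epsilon> * \<mu>) * ?V"
    using mult_right_mono[OF N, of ?V] by (simp add: sum_nonneg mult_ac)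
  also have "\<dots> \<le> \<epsilon> * herm_form I ?P v"
    using co \<epsilon> unfolding coercive_def by (simp add: mult.assoc)
  finally show ?thesis unfolding S by (simp add: algebra_simps)
qed

lemma partial_sum_le_dominating_kernel:
  assumes I: "finite I" "x0 \<in> I"
    and A: "schur_positive I A" "\<And>x. x \<in> I \<Longrightarrow> A x x0 = 0" "\<And>x. x \<in> I \<Longrightarrow> A x0 x = 0"
    and P: "psd I P" "\<And>x. x \<in> I \<Longrightarrow> P x x0 = 1" "\<And>x. x \<in> I \<Longrightarrow> P x0 x = 1"
    and a: "1 \<le> a" and psd: "psd I (\<lambda>x y. (of_real (a\<^sup>2) - A x y) * P x y)"
  shows "herm_form I (\<lambda>x y. \<Sum>n\<le>N. A x y ^ n) v \<le> a ^ (2 * N) * herm_form I P v"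
    and "psd I (\<lambda>x y. (of_real (a\<^sup>2) - A x y) * P x y - of_real (a\<^sup>2))"
proof -
  let ?L = "\<lambda>x y. (of_real (a\<^sup>2) - A x y) * P x y - of_real (a\<^sup>2)"
  show L: "psd I ?L"
  \<comment> \<open>At the base point \<open>A\<close> vanishes and \<open>P\<close> equals 1, so
    the constant to split off is \<open>a ^ 2\<close>.\<close>
  proof (rule psd_schur_complement[OF I, where c = "a\<^sup>2"])
    show "psd I (\<lambda>x y. of_real (a\<^sup>2) * 1 + ?L x y)"
      by (rule psd_cong[OF psd]) simp
  qed (simp_all only: A P diff_0_right mult_1_right diff_self)
  let ?A' = "\<lambda>x y. of_real (1 / a\<^sup>2) * A x y"
  have A': "schur_positive I ?A'" using A(1) by (intro schur_positive_scale) auto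
  have a0: "complex_of_real (1 / a\<^sup>2) * complex_of_real (a\<^sup>2) = 1"
    using a by (simp flip: of_real_mult)
  have "psd I (\<lambda>x y. of_real (1 / a\<^sup>2) * ?L x y)" using L by (intro psd_scale) auto
  then have L': "psd I (\<lambda>x y. (1 - ?A' x y) * P x y - 1)"
    by (rule psd_cong) (simp only: right_diff_distrib left_diff_distrib mult.assoc[symmetric] a0 mult_1_left)
  have S: "schur_positive I (\<lambda>x y. \<Sum>n\<le>N. ?A' x y ^ n)"
    by (intro schur_positive_sum schur_positive_power A')
  have tail: "psd I (\<lambda>x y. ?A' x y ^ Suc N * P x y)"
    by (intro schur_positiveD schur_positive_power A' P)
  \<comment> \<open>\<open>(1 - ?A') * P - 1\<close> times the partial sum telescopes to
    \<open>(1 - ?A' ^ Suc N) * P\<close> minus the partial sum; the positive remainder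
    \<open>?A' ^ Suc N * P\<close> completes \<open>P\<close>.\<close>
  have "psd I (\<lambda>x y. P x y - (\<Sum>n\<le>N. ?A' x y ^ n))"
  proof (rule psd_cong[OF psd_add[OF schur_positiveD[OF S L'] tail]])
    fix x y
    have "(\<Sum>n\<le>N. ?A' x y ^ n) * (1 - ?A' x y) = 1 - ?A' x y ^ Suc N"
      using sum_gp_basic[of "?A' x y" N] by (simp add: mult.commute)
    then have "(\<Sum>n\<le>N. ?A' x y ^ n) * ((1 - ?A' x y) * P x y - 1) = (1 - ?A' x y ^ Suc N) * P x y - (\<Sum>n\<le>N. ?A' x y ^ n)"
      by (simp only: right_diff_distrib mult.assoc[symmetric] mult_1_right)
    then show "(\<Sum>n\<le>N. ?A' x y ^ n) * ((1 - ?A' x y) * P x y - 1) + ?A' x y ^ Suc N * P x y = P x y - (\<Sum>n\<le>N. ?A' x y ^ n)"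
      by (simp only: left_diff_distrib) simp
  qed
  \<comment> \<open>As \<open>1 \<le> a\<close>, the coefficients \<open>1 / a ^ (2 * n)\<close> may
    all be lowered to the smallest, \<open>1 / a ^ (2 * N)\<close>.\<close>
  moreover have "psd I (\<lambda>x y. \<Sum>n\<le>N. of_real (1 / a ^ (2 * n) - 1 / a ^ (2 * N)) * A x y ^ n)"
    by (intro schur_positive_psd schur_positive_sum schur_positive_scale schur_positive_power A)
      (use a in \<open>simp add: frac_le power_increasing\<close>)
  ultimately have "psd I (\<lambda>x y. (P x y - (\<Sum>n\<le>N. ?A' x y ^ n)) +
      (\<Sum>n\<le>N. of_real (1 / a ^ (2 * n) - 1 / a ^ (2 * N)) * A x y ^ n))"
    by (rule psd_add)
  then have "psd I (\<lambda>x y. P x y - of_real (1 / a ^ (2 * N)) * (\<Sum>n\<le>N. A x y ^ n))"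
  proof (rule psd_cong)
    fix x y
    have "?A' x y ^ n = of_real (1 / a ^ (2 * n)) * A x y ^ n" for n
      by (simp only: power_mult_distrib of_real_power[symmetric] power_one_over power_mult)
    then show "(P x y - (\<Sum>n\<le>N. ?A' x y ^ n)) + (\<Sum>n\<le>N. of_real (1 / a ^ (2 * n) - 1 / a ^ (2 * N)) * A x y ^ n)
        = P x y - of_real (1 / a ^ (2 * N)) * (\<Sum>n\<le>N. A x y ^ n)"
      by (simp only: of_real_diff left_diff_distrib sum_subtractf sum_distrib_left) simp
  qed
  then have "1 / a ^ (2 * N) * herm_form I (\<lambda>x y. \<Sum>n\<le>N. A x y ^ n) v \<le> herm_form I P v"
    unfolding psd_def herm_form_diff herm_form_scale by simp
  then show "herm_form I (\<lambda>x y. \<Sum>n\<le>N. A x y ^ n) v \<le> a ^ (2 * N) * herm_form I P v"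
    using a by (simp add: pos_divide_le_eq mult.commute)
qed

text \<open>The condition on \<open>N\<close> involves only the size of \<open>I\<close> and data of
  \<open>A\<close>, namely \<open>q\<close> and \<open>\<mu>\<close>, besides
  \<open>\<epsilon>\<close>; it is blind to \<open>B\<close>.\<close>

lemma normalised_kernel_comparison:
  assumes I: "finite I" "x0 \<in> I"
    and A: "schur_positive I A" "\<And>x. x \<in> I \<Longrightarrow> A x x0 = 0" "\<And>x. x \<in> I \<Longrightarrow> A x0 x = 0"
    and B: "psd I (\<lambda>x y. 1 / (1 - B x y))" "\<And>x. x \<in> I \<Longrightarrow> B x x0 = 0" "\<And>x. x \<in> I \<Longrightarrow> B x0 x = 0"
    and q: "\<And>x y. x \<in> I \<Longrightarrow> y \<in> I \<Longrightarrow> cmod (A x y) \<le> q" "q < 1"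
    and a: "1 \<le> a" "psd I (\<lambda>x y. (of_real (a\<^sup>2) - A x y) * (1 / (1 - B x y)))"
    and co: "coercive I (\<lambda>x y. 1 / (1 - A x y)) \<mu>" and \<epsilon>: "0 < \<epsilon>"
    and N: "(1 + \<epsilon>) * (real (card I) * (q ^ Suc N / (1 - q))) \<le> \<epsilon> * \<mu>"
  shows "herm_form I (\<lambda>x y. 1 / (1 - A x y)) v \<le> (1 + \<epsilon>) * a ^ (2 * N) * herm_form I (\<lambda>x y. 1 / (1 - B x y)) v"
proof -
  have "herm_form I (\<lambda>x y. 1 / (1 - A x y)) v \<le> (1 + \<epsilon>) * herm_form I (\<lambda>x y. \<Sum>n\<le>N. A x y ^ n) v"
    by (rule geometric_kernel_le_partial_sum[OF I(1) q co \<epsilon> N])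
  also have "herm_form I (\<lambda>x y. \<Sum>n\<le>N. A x y ^ n) v \<le> a ^ (2 * N) * herm_form I (\<lambda>x y. 1 / (1 - B x y)) v"
    by (rule partial_sum_le_dominating_kernel(1)[OF I A B(1) _ _ a]) (simp_all add: B)
  finally show ?thesis using \<epsilon> by (simp add: mult.assoc)
qed

text \<open>The diagonal entry at \<open>z\<close> of the kernel left after splitting off the base
  point. For Gram kernels \<open>\<alpha>\<close> and \<open>\<beta>\<close> are squared
  pseudohyperbolic distances to the base point, so distances change at most by the factor
  \<open>a\<close>.\<close>

lemma diagonal_bound:
  assumes I: "finite I" "x0 \<in> I"
    and A: "schur_positive I A" "\<And>x. x \<in> I \<Longrightarrow> A x x0 = 0" "\<And>x. x \<in> I \<Longrightarrow> A x0 x = 0"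
    and B: "psd I (\<lambda>x y. 1 / (1 - B x y))" "\<And>x. x \<in> I \<Longrightarrow> B x x0 = 0" "\<And>x. x \<in> I \<Longrightarrow> B x0 x = 0"
    and a: "1 \<le> a" "psd I (\<lambda>x y. (of_real (a\<^sup>2) - A x y) * (1 / (1 - B x y)))"
    and z: "z \<in> I" "A z z = of_real \<alpha>" "B z z = of_real \<beta>" "\<beta> < 1"
  shows "\<alpha> \<le> a\<^sup>2 * \<beta>"
proof -
  have "psd I (\<lambda>x y. (of_real (a\<^sup>2) - A x y) * (1 / (1 - B x y)) - of_real (a\<^sup>2))"
    by (rule partial_sum_le_dominating_kernel(2)[OF I A B(1) _ _ a]) (simp_all add: B)
  from psd_diagonal[OF I(1) this z(1)]
  have "0 \<le> Re (of_real ((a\<^sup>2 - \<alpha>) * (1 / (1 - \<beta>)) - a\<^sup>2))"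
    unfolding z(2,3) by (simp del: Re_complex_of_real)
  then have "a\<^sup>2 \<le> (a\<^sup>2 - \<alpha>) / (1 - \<beta>)" by simp
  then have "a\<^sup>2 * (1 - \<beta>) \<le> a\<^sup>2 - \<alpha>" using z(4) by (simp add: pos_le_divide_eq)
  then show ?thesis by (simp add: right_diff_distrib)
qed

lemma geometric_tail_small:
  assumes "0 \<le> q" "q < 1" "0 < (c::real)"
  shows "\<exists>N0. \<forall>N\<ge>N0. s * (t * (q ^ Suc N / (1 - q))) \<le> c"
proof -
  have "(\<lambda>N. s * (t * (q ^ Suc N / (1 - q)))) \<longlonglongrightarrow> s * (t * (0 / (1 - q)))"
    using assms by (intro tendsto_intros LIMSEQ_Suc LIMSEQ_realpow_zero) auto
  then have "eventually (\<lambda>N. s * (t * (q ^ Suc N / (1 - q))) < c) sequentially"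
    by (rule order_tendstoD(2)) (use assms in simp)
  then show ?thesis unfolding eventually_sequentially by (meson less_imp_le)
qed

section \<open>Isomorphisms\<close>

lemma op_norm_le:
  assumes "rkhs K" "\<And>f. f \<in> funs H \<Longrightarrow> T f \<in> funs K"
    and "\<And>f. f \<in> funs H \<Longrightarrow> (fnorm K (T f))\<^sup>2 \<le> C * (fnorm H f)\<^sup>2" "0 \<le> C" "rkhs H"
  shows "op_norm H K T \<le> ennreal (sqrt C)"
  unfolding op_norm_def
proof (rule SUP_least)
  fix f assume "f \<in> {f \<in> funs H. fnorm H f \<le> 1}"
  then have f: "f \<in> funs H" "fnorm H f \<le> 1" by auto
  then have "(fnorm H f)\<^sup>2 \<le> 1" using rkhs.fnorm_nonneg[OF assms(5) f(1)] by (simp add: power_le_one)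
  then have "(fnorm K (T f))\<^sup>2 \<le> C"
    using assms(3)[OF f(1)] assms(4) mult_left_mono[of "(fnorm H f)\<^sup>2" 1 C] by simp
  then show "ennreal (fnorm K (T f)) \<le> ennreal (sqrt C)"
    by (intro ennreal_leI real_le_rsqrt)
qed

text \<open>The kernel functions form a basis, so sending the one at \<open>x\<close> to
  \<open>l x\<close> times the one at \<open>F x\<close> defines a linear map. The two Hermitian
  forms are the squared norms of a vector and of its image, and the inequalities bound the map and
  its inverse.\<close>

lemma delta_RK_le:
  assumes H: "finite_rkhs H" and K: "finite_rkhs K" and F: "bij_betw F (points H) (points K)"
    and l: "\<And>x. x \<in> points H \<Longrightarrow> l x \<noteq> 0" and C: "0 \<le> C" "0 \<le> C'"
    and le: "\<And>c. herm_form (points H) (\<lambda>x y. kernel_fun K (F y) (F x)) (\<lambda>x. c x * l x) \<le>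
      C * herm_form (points H) (\<lambda>x y. kernel_fun H y x) c"
    and ge: "\<And>c. herm_form (points H) (\<lambda>x y. kernel_fun H y x) c \<le>
      C' * herm_form (points H) (\<lambda>x y. kernel_fun K (F y) (F x)) (\<lambda>x. c x * l x)"
  shows "delta_RK H K \<le> ennreal (sqrt C * sqrt C')"
proof -
  interpret H: finite_rkhs H by (rule H)
  interpret K: finite_rkhs K by (rule K)
  let ?I = "points H" and ?J = "points K"
  note e = H.expansion_mem[OF H.finite_points order_refl] K.expansion_mem[OF K.finite_points order_refl]
  define F' where "F' = inv_into ?I F"
  have F': "F' (F x) = x" if "x \<in> ?I" for x
    unfolding F'_def by (rule bij_betw_inv_into_left[OF F that])
  have FF': "F (F' y) = y" "F' y \<in> ?I" if "y \<in> ?J" for y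
    unfolding F'_def using bij_betw_inv_into_right[OF F that] bij_betwE[OF bij_betw_inv_into[OF F]] that by auto
  define S where "S c = K.expansion (\<lambda>y. c (F' y) * l (F' y)) ?J" for c
  \<comment> \<open>By \<open>expansion_inj\<close> the chosen coefficients are determined on the
    points, and \<open>S\<close> reads them only there.\<close>
  define T where "T f = S (SOME c. f = H.expansion c ?I)" for f
  have S_cong: "S c = S d" if "\<And>x. x \<in> ?I \<Longrightarrow> c x = d x" for c d
    unfolding S_def K.expansion_def using that FF' by (intro ext sum.cong) auto
  have T: "T (H.expansion c ?I) = S c" for c
  proof -
    have "H.expansion c ?I = H.expansion (SOME d. H.expansion c ?I = H.expansion d ?I) ?I"
      by (rule someI[of "\<lambda>d. H.expansion c ?I = H.expansion d ?I"]) (rule refl)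
    then show ?thesis unfolding T_def by (intro S_cong) (metis H.expansion_inj)
  qed
  have S_mem: "S c \<in> funs K" for c unfolding S_def by (rule e)
  have T_mem: "T f \<in> funs K" for f unfolding T_def by (rule S_mem)
  have S_norm: "(fnorm K (S c))\<^sup>2 = herm_form ?I (\<lambda>x y. kernel_fun K (F y) (F x)) (\<lambda>x. c x * l x)" for c
    unfolding S_def K.fnorm_expansion[OF K.finite_points order_refl] herm_form_reindex[OF F]
    by (intro herm_form_cong) (auto simp: F')
  note H_norm = H.fnorm_expansion[OF H.finite_points order_refl]
  have up: "(fnorm K (T f))\<^sup>2 \<le> C * (fnorm H f)\<^sup>2" if f: "f \<in> funs H" for f
  proof -
    obtain c where c: "f = H.expansion c ?I" using H.funsE[OF f] .
    show ?thesis unfolding c T S_norm H_norm by (rule le)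
  qed
  have down: "(fnorm H f)\<^sup>2 \<le> C' * (fnorm K (T f))\<^sup>2" if f: "f \<in> funs H" for f
  proof -
    obtain c where c: "f = H.expansion c ?I" using H.funsE[OF f] .
    show ?thesis unfolding c T S_norm H_norm by (rule ge)
  qed
  have add: "T (\<lambda>x. f x + g x) = (\<lambda>y. T f y + T g y)" if f: "f \<in> funs H" and g: "g \<in> funs H" for f g
  proof -
    obtain c where c: "f = H.expansion c ?I" using H.funsE[OF f] .
    obtain d where d: "g = H.expansion d ?I" using H.funsE[OF g] .
    have "(\<lambda>x. f x + g x) = H.expansion (\<lambda>x. c x + d x) ?I"
      unfolding c d H.expansion_def by (simp add: sum.distrib ring_distribs)
    then have "T (\<lambda>x. f x + g x) = S (\<lambda>x. c x + d x)" by (simp only: T)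
    also have "\<dots> = (\<lambda>y. S c y + S d y)"
      unfolding S_def K.expansion_def by (simp add: sum.distrib ring_distribs)
    finally show ?thesis by (simp only: c d T)
  qed
  have scale: "T (\<lambda>x. t * f x) = (\<lambda>y. t * T f y)" if f: "f \<in> funs H" for f t
  proof -
    obtain c where c: "f = H.expansion c ?I" using H.funsE[OF f] .
    have "(\<lambda>x. t * f x) = H.expansion (\<lambda>x. t * c x) ?I"
      unfolding c H.expansion_def by (simp add: sum_distrib_left mult.assoc)
    then have "T (\<lambda>x. t * f x) = S (\<lambda>x. t * c x)" by (simp only: T)
    also have "\<dots> = (\<lambda>y. t * S c y)"
      unfolding S_def K.expansion_def by (simp add: sum_distrib_left mult.assoc)
    finally show ?thesis by (simp only: c T)
  qed
  have inj: "inj_on T (funs H)"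
  proof (rule inj_onI)
    fix f g assume fg: "f \<in> funs H" "g \<in> funs H" "T f = T g"
    let ?d = "\<lambda>x. f x + (-1) * g x"
    have d: "?d \<in> funs H" by (intro H.add_mem H.scale_mem fg)
    have "T ?d = (\<lambda>y. 0)"
      using add[OF fg(1) H.scale_mem[OF fg(2)], of "-1"] scale[OF fg(2), of "-1"] fg(3) by simp
    then have "(fnorm H ?d)\<^sup>2 \<le> 0" using down[OF d] K.fnorm_zero by simp
    then have "?d = (\<lambda>x. 0)" using H.ip_pos[OF d] H.fnorm_power2[OF d] by force
    then show "f = g" by (auto simp: fun_eq_iff)
  qed
  have surj: "T ` funs H = funs K"
  proof
    show "T ` funs H \<subseteq> funs K" using T_mem by auto
    show "funs K \<subseteq> T ` funs H"
    proof
      fix g assume "g \<in> funs K"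
      then obtain d where d: "g = K.expansion d ?J" by (rule K.funsE)
      have "T (H.expansion (\<lambda>x. d (F x) / l x) ?I) = g"
        unfolding T d S_def K.expansion_def using FF' l by (intro ext sum.cong) auto
      then show "g \<in> T ` funs H" using e(1) by blast
    qed
  qed
  have kern: "T (kernel_fun H x) = (\<lambda>y. l x * kernel_fun K (F x) y)" if x: "x \<in> ?I" for x
  proof -
    let ?\<delta> = "\<lambda>z. if z = x then 1 else (0::complex)"
    have "kernel_fun H x = H.expansion ?\<delta> ?I"
    proof
      fix w
      have "H.expansion ?\<delta> ?I w = (\<Sum>z\<in>?I. if z = x then kernel_fun H z w else 0)"
        unfolding H.expansion_def by (intro sum.cong) auto
      then show "kernel_fun H x w = H.expansion ?\<delta> ?I w" using x H.finite_points by simp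
    qed
    then have "T (kernel_fun H x) = S ?\<delta>" by (simp only: T)
    also have "\<dots> = (\<lambda>w. l x * kernel_fun K (F x) w)"
    proof
      fix w
      have "S ?\<delta> w = (\<Sum>y\<in>?J. if y = F x then l x * kernel_fun K y w else 0)"
        unfolding S_def K.expansion_def using FF' F' x by (intro sum.cong) auto
      then show "S ?\<delta> w = l x * kernel_fun K (F x) w"
        using x K.finite_points bij_betwE[OF F] by simp
    qed
    finally show ?thesis .
  qed
  have n1: "op_norm H K T \<le> ennreal (sqrt C)"
    by (rule op_norm_le[OF K.rkhs_axioms T_mem up C(1) H.rkhs_axioms])
  have inv: "inv_into (funs H) T g \<in> funs H" "T (inv_into (funs H) T g) = g" if "g \<in> funs K" for g
    using that surj inv_into_into[of g T "funs H"] f_inv_into_f[of g T "funs H"] by auto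
  have n2: "op_norm K H (inv_into (funs H) T) \<le> ennreal (sqrt C')"
    by (rule op_norm_le[OF H.rkhs_axioms inv(1) _ C(2) K.rkhs_axioms])
      (use down inv in fastforce)+
  have "rkhs_iso H K T"
    unfolding rkhs_iso_def bij_betw_def
    using inj surj add scale kern F l n1 by (auto intro!: exI[of _ F] exI[of _ l] simp: bij_betw_def order_le_less_trans)
  then have "delta_RK H K \<le> op_norm H K T * op_norm K H (inv_into (funs H) T)"
    unfolding delta_RK_def by (intro INF_lower) simp
  also have "\<dots> \<le> ennreal (sqrt C) * ennreal (sqrt C')" by (rule mult_mono[OF n1 n2]) auto
  also have "\<dots> = ennreal (sqrt C * sqrt C')" by (simp add: ennreal_mult C)
  finally show ?thesis .
qed

text \<open>The freedom in \<open>l\<close> absorbs the normalisation: taking the ratio of the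
  conjugated weights turns the forms of the original kernels into those of the normalised ones at
  the same vector.\<close>

lemma delta_RK_le_normalised:
  assumes H: "is_drury_arveson_on X H" "finite X" "X \<subseteq> l2_ball"
    and K: "is_drury_arveson_on Y K" "finite Y" "Y \<subseteq> l2_ball"
    and F: "bij_betw F X Y" and x0: "x0 \<in> l2_ball" and y0: "y0 \<in> l2_ball" and C: "0 \<le> C" "0 \<le> C'"
    and le: "\<And>v. herm_form X (\<lambda>x y. 1 / (1 - mobius_gram y0 (F x) (F y))) v \<le>
      C * herm_form X (\<lambda>x y. 1 / (1 - mobius_gram x0 x y)) v"
    and ge: "\<And>v. herm_form X (\<lambda>x y. 1 / (1 - mobius_gram x0 x y)) v \<le>
      C' * herm_form X (\<lambda>x y. 1 / (1 - mobius_gram y0 (F x) (F y))) v"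
  shows "delta_RK H K \<le> ennreal (sqrt C * sqrt C')"
proof -
  have pH: "points H = X" "\<And>x y. x \<in> X \<Longrightarrow> y \<in> X \<Longrightarrow> kernel_fun H y x = 1 / (1 - l2_inner x y)"
    and pK: "points K = Y" "\<And>x y. x \<in> Y \<Longrightarrow> y \<in> Y \<Longrightarrow> kernel_fun K y x = 1 / (1 - l2_inner x y)"
    using H(1) K(1) unfolding is_drury_arveson_on_def by auto
  have FY: "F x \<in> Y" if "x \<in> X" for x using F that by (rule bij_betw_apply)
  define u where "u x = cnj (weight x0 x)" for x
  define w where "w x = cnj (weight y0 (F x))" for x
  have u: "u x \<noteq> 0" and w: "w x \<noteq> 0" if "x \<in> X" for x
    using that weight_nonzero[OF x0] weight_nonzero[OF y0] H(3) K(3) FY by (auto simp: u_def w_def subset_iff)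
  have formH: "herm_form X (\<lambda>x y. kernel_fun H y x) c =
      herm_form X (\<lambda>x y. 1 / (1 - mobius_gram x0 x y)) (\<lambda>x. c x / u x)" for c
  proof -
    have "herm_form X (\<lambda>x y. 1 / (1 - mobius_gram x0 x y)) (\<lambda>x. c x / u x) =
        herm_form X (\<lambda>x y. weight x0 x * kernel_fun H y x * cnj (weight x0 y)) (\<lambda>x. c x / u x)"
      using H(3) by (intro herm_form_cong) (auto simp: pH(2) normalised_kernel_eq[OF x0] subset_iff)
    also have "\<dots> = herm_form X (\<lambda>x y. kernel_fun H y x) (\<lambda>x. c x / u x * u x)"
      unfolding herm_form_congruence u_def ..
    also have "\<dots> = herm_form X (\<lambda>x y. kernel_fun H y x) c"
      using u by (intro herm_form_cong) auto
    finally show ?thesis ..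
  qed
  have formK: "herm_form X (\<lambda>x y. kernel_fun K (F y) (F x)) (\<lambda>x. c x * (w x / u x)) =
      herm_form X (\<lambda>x y. 1 / (1 - mobius_gram y0 (F x) (F y))) (\<lambda>x. c x / u x)" for c
  proof -
    have "herm_form X (\<lambda>x y. 1 / (1 - mobius_gram y0 (F x) (F y))) (\<lambda>x. c x / u x) =
        herm_form X (\<lambda>x y. weight y0 (F x) * kernel_fun K (F y) (F x) * cnj (weight y0 (F y))) (\<lambda>x. c x / u x)"
      using K(3) FY by (intro herm_form_cong) (auto simp: pK(2) normalised_kernel_eq[OF y0] subset_iff)
    also have "\<dots> = herm_form X (\<lambda>x y. kernel_fun K (F y) (F x)) (\<lambda>x. c x / u x * w x)"
      unfolding herm_form_congruence w_def ..
    finally show ?thesis by (simp add: mult.commute)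
  qed
  show ?thesis
  proof (rule delta_RK_le[where l = "\<lambda>x. w x / u x" and F = F])
    show "finite_rkhs H" "finite_rkhs K"
      using drury_arveson_finite_rkhs H K by auto
    fix c
    show "herm_form (points H) (\<lambda>x y. kernel_fun K (F y) (F x)) (\<lambda>x. c x * (w x / u x)) \<le>
        C * herm_form (points H) (\<lambda>x y. kernel_fun H y x) c"
      unfolding pH(1) formH formK by (rule le)
    show "herm_form (points H) (\<lambda>x y. kernel_fun H y x) c \<le>
        C' * herm_form (points H) (\<lambda>x y. kernel_fun K (F y) (F x)) (\<lambda>x. c x * (w x / u x))"
      unfolding pH(1) formH formK by (rule ge)
  qed (use F u w C in \<open>auto simp: pH(1) pK(1)\<close>)
qed

section \<open>The estimate for one isomorphism and the passage to the infimum\<close>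

lemma delta_RK_bound_of_mult_iso:
  fixes X1 :: "(nat \<Rightarrow> complex) set" and r R \<epsilon> :: real
  assumes X1: "finite X1" "X1 \<noteq> {}" "X1 \<subseteq> l2_ball"
    and r: "0 \<le> r" "\<And>x y. x \<in> X1 \<Longrightarrow> y \<in> X1 \<Longrightarrow> pseudohyperbolic x y \<le> r"
    and R: "0 < R" "R < 1" and \<epsilon>: "0 < \<epsilon>"
  shows "\<exists>N. \<forall>H1 X2 H2 \<phi> a b. is_drury_arveson_on X1 H1 \<longrightarrow> X2 \<subseteq> l2_ball \<longrightarrow>
    is_drury_arveson_on X2 H2 \<longrightarrow> mult_iso H1 H2 \<phi> \<longrightarrow>
    cb_norm H1 H2 \<phi> = ennreal a \<longrightarrow> 0 \<le> a \<longrightarrow> cb_norm H2 H1 (inv_into (Mult H1) \<phi>) = ennreal b \<longrightarrow> 0 \<le> b \<longrightarrow>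
    (r \<noteq> 0 \<longrightarrow> a * b < R / r) \<longrightarrow> delta_RK H1 H2 \<le> ennreal ((1 + \<epsilon>) * (a * b) ^ N)"
proof -
  obtain x0 where x0: "x0 \<in> X1" using X1(2) by blast
  then have x0b: "x0 \<in> l2_ball" using X1(3) by blast
  let ?A = "mobius_gram x0"
  let ?P = "\<lambda>x y. 1 / (1 - ?A x y)"
  obtain \<mu> where \<mu>: "0 < \<mu>" "coercive X1 ?P \<mu>"
    using coercive_kernel[OF X1(1,3)] coercive_normalised_kernel[OF X1(1,3) x0b] by blast
  have q: "0 \<le> R\<^sup>2" "R\<^sup>2 < 1" using R by (auto simp: power_less_one_iff)
  define tail where "tail N = (1 + \<epsilon>) * (real (card X1) * ((R\<^sup>2) ^ Suc N / (1 - R\<^sup>2)))" for N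
  have ex_tail: "\<exists>N0. \<forall>N\<ge>N0. tail N \<le> \<epsilon> * \<nu>" if "0 < \<nu>" for \<nu>
    unfolding tail_def by (rule geometric_tail_small) (use q \<epsilon> that in auto)
  obtain N1 where N1: "\<And>N. N1 \<le> N \<Longrightarrow> tail N \<le> \<epsilon> * \<mu>" using ex_tail[OF \<mu>(1)] by blast
  \<comment> \<open>A lower bound for the kernel of the second space that is known before that
    space: the first comparison with exponent \<open>N1\<close> costs
    \<open>(1 + \<epsilon>) * a ^ (2 * N1)\<close>, and \<open>a \<le> R / r\<close>. For
    \<open>r = 0\<close> there is a single point, where the normalised kernel is 1.\<close>
  define \<mu>2 where "\<mu>2 = (if r = 0 then 1 else \<mu> / ((1 + \<epsilon>) * (R / r) ^ (2 * N1)))"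
  have \<mu>2: "0 < \<mu>2" using \<mu>(1) \<epsilon> R r(1) by (simp add: \<mu>2_def)
  obtain N2 where N2: "\<And>N. N2 \<le> N \<Longrightarrow> tail N \<le> \<epsilon> * \<mu>2" using ex_tail[OF \<mu>2] by blast
  define N where "N = max N1 N2"
  have "delta_RK H1 H2 \<le> ennreal ((1 + \<epsilon>) * (a * b) ^ N)"
    if H1: "is_drury_arveson_on X1 H1" and X2: "X2 \<subseteq> l2_ball" and H2: "is_drury_arveson_on X2 H2"
      and iso: "mult_iso H1 H2 \<phi>" and a: "cb_norm H1 H2 \<phi> = ennreal a" "0 \<le> a"
      and b: "cb_norm H2 H1 (inv_into (Mult H1) \<phi>) = ennreal b" "0 \<le> b"
      and ab: "r \<noteq> 0 \<Longrightarrow> a * b < R / r" for H1 X2 H2 \<phi> a b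
  proof -
    have p: "points H1 = X1" "points H2 = X2" using H1 H2 unfolding is_drury_arveson_on_def by auto
    obtain G where G: "bij_betw G X2 X1" "\<And>f y. f \<in> Mult H1 \<Longrightarrow> y \<in> X2 \<Longrightarrow> \<phi> f y = f (G y)"
      using iso unfolding mult_iso_def p by blast
    define F where "F = inv_into X2 G"
    have F: "bij_betw F X1 X2" unfolding F_def by (rule bij_betw_inv_into[OF G(1)])
    have GF: "G (F x) = x" if "x \<in> X1" for x
      unfolding F_def by (rule bij_betw_inv_into_right[OF G(1) that])
    have G_mem: "G y \<in> X1" if "y \<in> X2" for y using G(1) that by (rule bij_betw_apply)
    have F_mem: "F x \<in> X2" if "x \<in> X1" for x using F that by (rule bij_betw_apply)
    have X2f: "finite X2" using bij_betw_finite[OF F] X1(1) by simp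
    have Fb: "F x \<in> l2_ball" if "x \<in> X1" for x using F_mem[OF that] X2 by blast
    have X1b: "x \<in> l2_ball" if "x \<in> X1" for x using X1(3) that by blast
    have inv: "inv_into (Mult H1) \<phi> f x = f (F x)" if f: "f \<in> Mult H2" and x: "x \<in> X1" for f x
    proof -
      have "bij_betw \<phi> (Mult H1) (Mult H2)" using iso unfolding mult_iso_def by blast
      then have "inv_into (Mult H1) \<phi> f \<in> Mult H1" "\<phi> (inv_into (Mult H1) \<phi> f) = f"
        using f by (auto simp: bij_betw_def inv_into_into f_inv_into_f)
      then show ?thesis using G(2)[OF _ F_mem[OF x]] GF[OF x] by metis
    qed
    have fin: "finite_rkhs H1" "finite_rkhs H2"
      using drury_arveson_finite_rkhs H1 H2 X1 X2f X2 by auto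
    have a1: "1 \<le> a"
      by (rule cb_norm_ge_1[where G = G and \<psi> = \<phi>, OF fin, unfolded p]) (use G G_mem a F_mem[OF x0] in auto)
    have b1: "1 \<le> b"
      by (rule cb_norm_ge_1[where G = F and \<psi> = "inv_into (Mult H1) \<phi>", OF fin(2,1), unfolded p])
        (use inv F_mem b x0 in auto)
    define y0 where "y0 = F x0"
    have y0b: "y0 \<in> l2_ball" unfolding y0_def by (rule Fb[OF x0])
    \<comment> \<open>Pulled back along \<open>F\<close>, both Gram kernels live on
      \<open>X1\<close> and share the base point \<open>x0\<close>.\<close>
    let ?B = "\<lambda>x y. mobius_gram y0 (F x) (F y)"
    let ?Q = "\<lambda>x y. 1 / (1 - ?B x y)"
    have "psd X2 (\<lambda>x y. (of_real (a\<^sup>2) - ?A (G x) (G y)) * (1 / (1 - mobius_gram y0 x y)))"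
      by (rule cb_norm_mobius_psd[where G = G and \<psi> = \<phi>, OF H1 X1(1,3) H2 X2f X2])
        (use G(2) G_mem a a1 x0b y0b in auto)
    from psd_reindex[OF F this]
    have psdA: "psd X1 (\<lambda>x y. (of_real (a\<^sup>2) - ?A x y) * ?Q x y)"
      by (rule psd_cong) (simp add: GF)
    have psdB: "psd X1 (\<lambda>x y. (of_real (b\<^sup>2) - ?B x y) * ?P x y)"
      by (rule cb_norm_mobius_psd[where G = F and \<psi> = "inv_into (Mult H1) \<phi>", OF H2 X2f X2 H1 X1(1,3)])
        (use inv F_mem b b1 x0b y0b in auto)
    have A: "schur_positive X1 ?A" "\<And>x. x \<in> X1 \<Longrightarrow> ?A x x0 = 0" "\<And>x. x \<in> X1 \<Longrightarrow> ?A x0 x = 0"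
      using schur_positive_mobius_gram[OF x0b X1(3)] mobius_gram_base[OF x0b] X1b by auto
    have Bs: "schur_positive X1 ?B"
    proof -
      have "schur_positive X1 (\<lambda>x y. mobius_gram y0 (F x) (F y) - (\<Sum>l<0. ball_automorphism y0 (F x) l * cnj (ball_automorphism y0 (F y) l)))"
        unfolding mobius_gram_def
        by (rule schur_positive_l2_tail) (use square_summable_ball_automorphism[OF y0b] Fb in blast)
      then show ?thesis by simp
    qed
    have B: "schur_positive X1 ?B" "\<And>x. x \<in> X1 \<Longrightarrow> ?B x x0 = 0" "\<And>x. x \<in> X1 \<Longrightarrow> ?B x0 x = 0"
      using Bs mobius_gram_base[OF y0b] Fb unfolding y0_def by auto
    have P: "psd X1 ?P"
      by (intro schur_positive_psd schur_positive_geometric A cmod_mobius_gram_less_1 x0b X1b)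
    have Q: "psd X1 ?Q"
      by (intro schur_positive_psd schur_positive_geometric B cmod_mobius_gram_less_1 y0b Fb)
    have pos: "0 \<le> pseudohyperbolic x x0" if "x \<in> X1" for x
      unfolding pseudohyperbolic_def
      by (intro l2_norm_nonneg square_summable_ball_automorphism x0b X1b that)
    \<comment> \<open>Both follow from \<open>a * b * r < R\<close>, because \<open>a\<close> and
      \<open>b\<close> are at least 1. The first bounds the entries of \<open>?A\<close> by
      \<open>R ^ 2\<close>, the second those of \<open>?B\<close>.\<close>
    have rR: "r \<le> R" "b * r \<le> R"
    proof -
      have "r \<le> R \<and> b * r \<le> R"
      proof (cases "r = 0")
        case False
        then have r0: "0 < r" using r(1) by simp
        then have lt: "a * b * r < R" using ab[OF False] by (simp add: pos_less_divide_eq)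
        have "b * r \<le> a * (b * r)" using a1 b1 r0 by simp
        moreover have "r \<le> b * r" using b1 r0 by simp
        ultimately show ?thesis using lt by (simp add: mult.assoc)
      qed (use R in simp)
      then show "r \<le> R" "b * r \<le> R" by auto
    qed
    have Adiag: "(pseudohyperbolic x x0)\<^sup>2 \<le> R\<^sup>2" if "x \<in> X1" for x
      using r(2)[OF that x0] pos[OF that] rR(1) by (intro power_mono) auto
    \<comment> \<open>The diagonal estimate for the inverse isomorphism, so with factor
      \<open>b\<close> and the roles of \<open>?A\<close> and \<open>?B\<close> exchanged.\<close>
    have Bdiag: "(pseudohyperbolic (F x) y0)\<^sup>2 \<le> R\<^sup>2" if x: "x \<in> X1" for x
    proof -
      have "(pseudohyperbolic (F x) y0)\<^sup>2 \<le> b\<^sup>2 * (pseudohyperbolic x x0)\<^sup>2"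
        by (rule diagonal_bound[OF X1(1) x0 B P A(2,3) b1 psdB x])
          (use mobius_gram_diagonal[OF y0b Fb[OF x]] mobius_gram_diagonal[OF x0b X1b[OF x]]
            pseudohyperbolic_less_1(1)[OF x0b X1b[OF x]] in auto)
      also have "\<dots> = (b * pseudohyperbolic x x0)\<^sup>2" by (simp add: power_mult_distrib)
      also have "\<dots> \<le> R\<^sup>2"
      proof (rule power_mono)
        have "b * pseudohyperbolic x x0 \<le> b * r"
          using r(2)[OF x x0] b1 by (intro mult_left_mono) auto
        then show "b * pseudohyperbolic x x0 \<le> R" using rR(2) by simp
      qed (use pos[OF x] b1 in simp)
      finally show ?thesis .
    qed
    have qA: "cmod (?A x y) \<le> R\<^sup>2" and qB: "cmod (?B x y) \<le> R\<^sup>2" if "x \<in> X1" "y \<in> X1" for x y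
      using that by (auto intro!: cmod_mobius_gram_le x0b y0b X1b Fb Adiag Bdiag)
    have AQ: "herm_form X1 ?P v \<le> (1 + \<epsilon>) * a ^ (2 * n) * herm_form X1 ?Q v" if "N1 \<le> n" for v n
      by (rule normalised_kernel_comparison[OF X1(1) x0 A Q B(2,3) qA q(2) a1 psdA \<mu>(2) \<epsilon> N1[OF that, unfolded tail_def]])
    have "coercive X1 ?Q \<mu>2"
      unfolding coercive_def
    proof
      fix v
      let ?V = "\<Sum>x\<in>X1. (cmod (v x))\<^sup>2"
      show "\<mu>2 * ?V \<le> herm_form X1 ?Q v"
      proof (cases "r = 0")
        case True
        have "x = x0" if x: "x \<in> X1" for x
          using pseudohyperbolic_less_1(2)[OF x0b X1b[OF x]] r(2)[OF x x0] pos[OF x] True by force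
        then have X1eq: "X1 = {x0}" using x0 by blast
        have "?B x0 x0 = 0" using B(2)[OF x0] .
        then have "herm_form X1 ?Q v = Re (v x0 * cnj (v x0))" by (simp add: herm_form_def X1eq)
        also have "\<dots> = ?V" by (simp add: X1eq cmod_power2 flip: power2_eq_square)
        finally show ?thesis using True by (simp add: \<mu>2_def)
      next
        case False
        define D where "D = (1 + \<epsilon>) * (R / r) ^ (2 * N1)"
        have D: "0 < D" using \<epsilon> R False r(1) by (simp add: D_def)
        have "a \<le> a * b" using a1 b1 by simp
        then have "a \<le> R / r" using ab[OF False] by simp
        then have le: "(1 + \<epsilon>) * a ^ (2 * N1) \<le> D"
          unfolding D_def using a1 \<epsilon> by (intro mult_left_mono power_mono) auto
        have "\<mu> * ?V \<le> herm_form X1 ?P v" using \<mu>(2) unfolding coercive_def by blast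
        also have "\<dots> \<le> (1 + \<epsilon>) * a ^ (2 * N1) * herm_form X1 ?Q v" by (rule AQ) simp
        also have "\<dots> \<le> D * herm_form X1 ?Q v"
          using le Q unfolding psd_def by (intro mult_right_mono) auto
        finally have "\<mu> * ?V / D \<le> herm_form X1 ?Q v" using D by (simp add: pos_divide_le_eq mult.commute)
        then show ?thesis using False by (simp add: \<mu>2_def D_def)
      qed
    qed
    then have BP: "herm_form X1 ?Q v \<le> (1 + \<epsilon>) * b ^ (2 * N) * herm_form X1 ?P v" for v
      by (intro normalised_kernel_comparison[OF X1(1) x0 B P A(2,3) qB q(2) b1 psdB _ \<epsilon> N2[unfolded tail_def]])
        (auto simp: N_def)
    have "delta_RK H1 H2 \<le> ennreal (sqrt ((1 + \<epsilon>) * b ^ (2 * N)) * sqrt ((1 + \<epsilon>) * a ^ (2 * N)))"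
      by (rule delta_RK_le_normalised[OF H1 X1(1,3) H2 X2f X2 F x0b y0b _ _ BP AQ])
        (use a1 b1 \<epsilon> in \<open>auto simp: N_def\<close>)
    also have "sqrt ((1 + \<epsilon>) * b ^ (2 * N)) * sqrt ((1 + \<epsilon>) * a ^ (2 * N)) = (1 + \<epsilon>) * (a * b) ^ N"
    proof -
      have "(1 + \<epsilon>) * b ^ (2 * N) * ((1 + \<epsilon>) * a ^ (2 * N)) = ((1 + \<epsilon>) * (a * b) ^ N)\<^sup>2"
        by (simp add: power_mult_distrib power_mult[symmetric] power2_eq_square[of "1 + \<epsilon>"] mult_ac)
      then show ?thesis
        unfolding real_sqrt_mult[symmetric] using a1 b1 \<epsilon> by simp
    qed
    finally show ?thesis .
  qed
  then show ?thesis by blast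
qed

theorem proposition4p7:
  fixes d :: enat and X1 :: "(nat \<Rightarrow> complex) set" and r R \<epsilon> :: real
  assumes "finite X1" and "X1 \<noteq> {}" and "X1 \<subseteq> unit_ball d"
    and "r = Max {pseudohyperbolic x y | x y. x \<in> X1 \<and> y \<in> X1}"
    and "0 < R" and "R < 1" and "0 < \<epsilon>"
  shows "\<exists>N0::nat. \<forall>H1 X2 H2.
    is_drury_arveson_on X1 H1 \<longrightarrow> X2 \<subseteq> unit_ball d \<longrightarrow> is_drury_arveson_on X2 H2 \<longrightarrow>
    delta_M H1 H2 < (if r = 0 then \<infinity> else ennreal (R / r)) \<longrightarrow>
    delta_RK H1 H2 \<le> ennreal (1 + \<epsilon>) * delta_M H1 H2 ^ N0"
proof -
  have X1b: "X1 \<subseteq> l2_ball" using assms(3) unit_ball_subset by blast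
  have "{pseudohyperbolic x y | x y. x \<in> X1 \<and> y \<in> X1} = (\<lambda>(x, y). pseudohyperbolic x y) ` (X1 \<times> X1)"
    by auto
  then have fin: "finite {pseudohyperbolic x y | x y. x \<in> X1 \<and> y \<in> X1}"
    using assms(1) by simp
  have r: "pseudohyperbolic x y \<le> r" if "x \<in> X1" "y \<in> X1" for x y
    unfolding assms(4) using that by (intro Max_ge[OF fin]) blast
  have r0: "0 \<le> r"
  proof -
    obtain x where x: "x \<in> X1" using assms(2) by blast
    then have "0 \<le> pseudohyperbolic x x"
      unfolding pseudohyperbolic_def using X1b by (intro l2_norm_nonneg square_summable_ball_automorphism) auto
    then show ?thesis using r[OF x x] by simp
  qed
  obtain N where N: "\<And>H1 X2 H2 \<phi> a b. is_drury_arveson_on X1 H1 \<Longrightarrow> X2 \<subseteq> l2_ball \<Longrightarrow>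
    is_drury_arveson_on X2 H2 \<Longrightarrow> mult_iso H1 H2 \<phi> \<Longrightarrow>
    cb_norm H1 H2 \<phi> = ennreal a \<Longrightarrow> 0 \<le> a \<Longrightarrow> cb_norm H2 H1 (inv_into (Mult H1) \<phi>) = ennreal b \<Longrightarrow> 0 \<le> b \<Longrightarrow>
    (r \<noteq> 0 \<Longrightarrow> a * b < R / r) \<Longrightarrow> delta_RK H1 H2 \<le> ennreal ((1 + \<epsilon>) * (a * b) ^ N)"
    using delta_RK_bound_of_mult_iso[OF assms(1,2) X1b r0 r assms(5-7)] by blast
  show ?thesis
  proof (intro exI[of _ N] allI impI)
    fix H1 X2 H2
    assume H1: "is_drury_arveson_on X1 H1" and X2: "X2 \<subseteq> unit_ball d" and H2: "is_drury_arveson_on X2 H2"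
      and lt: "delta_M H1 H2 < (if r = 0 then \<infinity> else ennreal (R / r))"
    have X2b: "X2 \<subseteq> l2_ball" using X2 unit_ball_subset by blast
    \<comment> \<open>The strict bound excludes the value \<open>\<infinity>\<close>, so some
      isomorphism exists.\<close>
    have "delta_M H1 H2 < \<infinity>"
      using lt less_trans[OF lt, of \<infinity>] by (cases "r = 0") (auto split: if_splits)
    then obtain D where D: "0 \<le> D" "delta_M H1 H2 = ennreal D"
      by (cases "delta_M H1 H2") auto
    \<comment> \<open>The infimum need not be attained, so an isomorphism is taken whose product of
      norms lies below \<open>D + \<eta>\<close> and, if \<open>r\<close> is not 0, also below
      \<open>R / r\<close>.\<close>
    have bound: "delta_RK H1 H2 \<le> ennreal ((1 + \<epsilon>) * (D + \<eta>) ^ N)" if \<eta>: "0 < \<eta>" for \<eta>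
    proof -
      have "delta_M H1 H2 < ennreal (D + \<eta>)" using D \<eta> by (simp add: ennreal_less_iff)
      then have "delta_M H1 H2 < min (ennreal (D + \<eta>)) (if r = 0 then \<infinity> else ennreal (R / r))"
        using lt by simp
      then obtain \<phi> where \<phi>: "mult_iso H1 H2 \<phi>"
        "cb_norm H1 H2 \<phi> * cb_norm H2 H1 (inv_into (Mult H1) \<phi>) < min (ennreal (D + \<eta>)) (if r = 0 then \<infinity> else ennreal (R / r))"
        unfolding delta_M_def INF_less_iff by blast
      have "cb_norm H1 H2 \<phi> < \<infinity>" "cb_norm H2 H1 (inv_into (Mult H1) \<phi>) < \<infinity>"
        using \<phi>(1) unfolding mult_iso_def by blast+
      then obtain a b where a: "0 \<le> a" "cb_norm H1 H2 \<phi> = ennreal a"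
        and b: "0 \<le> b" "cb_norm H2 H1 (inv_into (Mult H1) \<phi>) = ennreal b"
        by (cases "cb_norm H1 H2 \<phi>"; cases "cb_norm H2 H1 (inv_into (Mult H1) \<phi>)") auto
      have ab: "ennreal (a * b) < ennreal (D + \<eta>)" "ennreal (a * b) < (if r = 0 then \<infinity> else ennreal (R / r))"
        using \<phi>(2) a b by (simp_all add: ennreal_mult)
      then have "a * b < D + \<eta>" using a b by (simp add: ennreal_less_iff)
      moreover have "a * b < R / r" if "r \<noteq> 0"
        using ab(2) that a b by (simp add: ennreal_less_iff)
      then have "delta_RK H1 H2 \<le> ennreal ((1 + \<epsilon>) * (a * b) ^ N)"
        using N[OF H1 X2b H2 \<phi>(1) a(2,1) b(2,1)] by blast
      moreover have "(1 + \<epsilon>) * (a * b) ^ N \<le> (1 + \<epsilon>) * (D + \<eta>) ^ N"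
        using a b assms(7) \<open>a * b < D + \<eta>\<close> by (intro mult_left_mono power_mono) auto
      ultimately show ?thesis by (meson ennreal_leI order_trans)
    qed
    \<comment> \<open>\<open>N\<close> was fixed before \<open>\<eta>\<close>, so
      \<open>\<eta>\<close> may tend to 0.\<close>
    have "((\<lambda>\<eta>. ennreal ((1 + \<epsilon>) * (D + \<eta>) ^ N)) \<longlongrightarrow> ennreal ((1 + \<epsilon>) * (D + 0) ^ N)) (at_right 0)"
      by (intro tendsto_intros)
    moreover have "eventually (\<lambda>\<eta>. delta_RK H1 H2 \<le> ennreal ((1 + \<epsilon>) * (D + \<eta>) ^ N)) (at_right 0)"
      using bound by (auto simp: eventually_at_right_field intro!: exI[of _ 1])
    ultimately have "delta_RK H1 H2 \<le> ennreal ((1 + \<epsilon>) * (D + 0) ^ N)"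
      by (rule tendsto_lowerbound) simp
    then show "delta_RK H1 H2 \<le> ennreal (1 + \<epsilon>) * delta_M H1 H2 ^ N"
      using D assms(7) by (simp add: ennreal_mult ennreal_power)
  qed
qed

end
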